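(* There exists an invertible measure-preserving transformation $T$ of a nonatomic $\sigma$-finite infinite standard Borel measure space $(X,\mathcal S,\mu)$ which is weak doubly ergodic and partially rigid, but such that $T\times T$ is not ergodic (with respect to $\mu\times\mu$).
   Context: A transformation $R$ is ergodic if every invariant measurable set is null or has null complement. $T$ is weak doubly ergodic if for every pair of measurable sets $A,B$ of positive measure there is a positive integer $n$ with $\mu(A\cap T^{-n}A)>0$ and $\mu(B\cap T^{-n}A)>0$. For $0<\rho\le 1$, $T$ is at least $\rho$-partially rigid if for every measurable set $A$ of finite measure there is a sequence of integers $n_m\to\infty$ with $\lim_{m\to\infty}\mu(A\cap T^{n_m}A)\ge\rho\,\mu(A)$. $T$ is partially rigid if it is at least $\rho$-partially rigid for some $0<\rho\le 1$. *)

theory Defs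
  imports "HOL-Analysis.Analysis"
begin

definition standard_Borel_measure :: "'a measure \<Rightarrow> bool" where
  "standard_Borel_measure M \<longleftrightarrow>
     (\<exists>X. completely_metrizable_space X \<and> separable_space X \<and>
          topspace X = space M \<and> sets M = sigma_sets (topspace X) {U. openin X U})"

definition measure_atom :: "'a measure \<Rightarrow> 'a set \<Rightarrow> bool" where
  "measure_atom M A \<longleftrightarrow>
     A \<in> sets M \<and> emeasure M A > 0 \<and>
     (\<forall>B\<in>sets M. B \<subseteq> A \<longrightarrow> emeasure M B = 0 \<or> emeasure M (A - B) = 0)"

definition nonatomic :: "'a measure \<Rightarrow> bool" where
  "nonatomic M \<longleftrightarrow> (\<nexists>A. measure_atom M A)"

definition invertible_mpt :: "'a measure \<Rightarrow> ('a \<Rightarrow> 'a) \<Rightarrow> bool" where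
  "invertible_mpt M T \<longleftrightarrow>
     bij_betw T (space M) (space M) \<and>
     T \<in> measurable M M \<and>
     the_inv_into (space M) T \<in> measurable M M \<and>
     (\<forall>A\<in>sets M. emeasure M (T -` A \<inter> space M) = emeasure M A)"

definition ergodic :: "'a measure \<Rightarrow> ('a \<Rightarrow> 'a) \<Rightarrow> bool" where
  "ergodic M R \<longleftrightarrow>
     (\<forall>A\<in>sets M. R -` A \<inter> space M = A \<longrightarrow>
        emeasure M A = 0 \<or> emeasure M (space M - A) = 0)"

definition weak_doubly_ergodic :: "'a measure \<Rightarrow> ('a \<Rightarrow> 'a) \<Rightarrow> bool" where
  "weak_doubly_ergodic M T \<longleftrightarrow>
     (\<forall>A\<in>sets M. \<forall>B\<in>sets M. emeasure M A > 0 \<longrightarrow> emeasure M B > 0 \<longrightarrow>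
        (\<exists>n::nat. n > 0 \<and>
           emeasure M (A \<inter> ((T ^^ n) -` A \<inter> space M)) > 0 \<and>
           emeasure M (B \<inter> ((T ^^ n) -` A \<inter> space M)) > 0))"

text \<open>A sequence of integers tending to infinity is eventually nonnegative, so the times are
  taken to be natural numbers. The limit is required to exist. The values are finite because
  the set has finite measure.\<close>

definition at_least_partially_rigid :: "real \<Rightarrow> 'a measure \<Rightarrow> ('a \<Rightarrow> 'a) \<Rightarrow> bool" where
  "at_least_partially_rigid \<rho> M T \<longleftrightarrow>
     (\<forall>A\<in>sets M. emeasure M A < \<infinity> \<longrightarrow>
        (\<exists>(n :: nat \<Rightarrow> nat) L. filterlim n at_top sequentially \<and>
           (\<lambda>m. measure M (A \<inter> (T ^^ n m) ` A)) \<longlonglongrightarrow> L \<and>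
           L \<ge> \<rho> * measure M A))"

definition partially_rigid :: "'a measure \<Rightarrow> ('a \<Rightarrow> 'a) \<Rightarrow> bool" where
  "partially_rigid M T \<longleftrightarrow> (\<exists>\<rho>. 0 < \<rho> \<and> \<rho> \<le> 1 \<and> at_least_partially_rigid \<rho> M T)"

end

theory Submission
  imports Defs "HOL-Probability.Probability" "HOL-Library.Discrete_Functions"
    "HOL-Real_Asymp.Real_Asymp"
begin

text \<open>
  The transformation is of rank one: column \<open>i\<close>, of height \<open>h\<close>, is cut into \<open>i + 40\<close> copies that are
  placed at prescribed offsets in column \<open>i + 1\<close>. A point of the base is a sequence of digits, and two
  points with equal tails lie on one orbit, at a time equal to the total difference of the offsets of
  their digits. With \<open>q = i + 37\<close> and \<open>H = 2 (h + \<bar>d\<bar>)\<close>, the offsets are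
  \<open>0, H, 2H, \<dots>, qH\<close>, then \<open>2qH\<close> and \<open>3qH + d\<close>, and the last three copies are called special.

  The progression \<open>0, H, \<dots>, qH\<close> makes \<open>H\<close> a rigidity time. The times between consecutive special
  copies are \<open>qH\<close> and \<open>qH + d\<close>. Each integer serves as \<open>d\<close> so often that almost every point has
  infinitely many special digits at stages with this \<open>d\<close>, since the probabilities \<open>3 / (i + 40)\<close> have
  divergent sum. This yields, for all sets of positive measure, one time \<open>n\<close> at which two prescribed
  returns occur together. But two independent points have special digits at the same stage with
  probability \<open>9 / (i + 40)\<^sup>2\<close>, which is summable. On the set of pairs for which this never happens, the
  difference of offsets at each stage is an invariant of the Cartesian square, because the
  progression is too sparse for lower stages to compensate a change.
\<close>


text \<open>Both returns must happen at one time \<open>n\<close>, so they are produced by digit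
  changes at one stage: replacing the first special digit by the second returns to \<open>A\<close>,
  and replacing the second by the third leads from \<open>B\<close> to \<open>A\<close>. The surplus
  \<open>d\<close> of the second change absorbs the fixed time that separates the chosen parts of
  \<open>A\<close> and \<open>B\<close>, which may be any integer. Almost every point must thus meet
  special digits infinitely often along the stages of every single \<open>d\<close>. As the
  admissible probability is only of order 1/i, these stages must not be sparse: \<open>d\<close> is
  constant on dyadic blocks, and one block already contributes a fixed amount.

  The places \<open>q\<close>, \<open>2q\<close>, \<open>3q\<close> of the special copies are chosen
  so that a difference of two places, not both special, reveals whether the shifted last copy takes
  part and on which side. Hence a change of the difference is a nonzero multiple of \<open>H\<close>
  plus at most two copies of \<open>d\<close>, which is at least \<open>2h\<close> in absolute value
  by the choice of \<open>H\<close>, while all lower stages together contribute at most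
  \<open>2h - 2\<close>. Stage 0 is left free of conditions, and its difference is the invariant
  that tells two sets of pairs apart.\<close>

lemma measurable_less_nat:
  fixes f g :: "'a \<Rightarrow> nat"
  assumes "f \<in> measurable M (count_space UNIV)" "g \<in> measurable M (count_space UNIV)"
  shows "{x \<in> space M. f x < g x} \<in> sets M"
proof -
  have "{x \<in> space M. f x < g x} = (\<Union>k. (f -` {..<k} \<inter> space M) \<inter> (g -` {k} \<inter> space M))" by auto
  moreover have "f -` {..<k} \<inter> space M \<in> sets M" "g -` {k} \<inter> space M \<in> sets M" for k
    using measurable_sets[OF assms(1), of "{..<k}"] measurable_sets[OF assms(2), of "{k}"] by auto
  ultimately show ?thesis by auto
qed

lemma funpow_inverse:
  fixes f g :: "'a \<Rightarrow> 'a"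
  assumes "\<And>p. f (g p) = p"
  shows "(f ^^ n) ((g ^^ n) p) = p"
  by (induction n arbitrary: p) (simp_all add: funpow_swap1[of g] assms)

lemma funpow_map_prod:
  fixes f :: "'a \<Rightarrow> 'a" and g :: "'b \<Rightarrow> 'b"
  shows "(map_prod f g ^^ n) p = ((f ^^ n) (fst p), (g ^^ n) (snd p))"
  by (induction n) auto

lemma measurable_funpow: "f \<in> measurable N N \<Longrightarrow> f ^^ n \<in> measurable N N"
  by (induction n) (auto intro: measurable_comp simp: id_def)

section \<open>Towers over odometers\<close>

text \<open>Digit \<open>a\<close> at place \<open>i\<close> stands for the copy of column \<open>i\<close> at offset \<open>s i a\<close> in column \<open>i + 1\<close>. The
  return times of the odometer make the offset of a point increase by one under each step of the
  tower map. Off the tower, which carries all the mass, the map is the identity.\<close>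


locale cutting =
  fixes m :: "nat \<Rightarrow> nat" and s :: "nat \<Rightarrow> nat \<Rightarrow> int"
  assumes m_pos: "0 < m i"
    and s_zero [simp]: "s i 0 = 0"
    and s_gap: "a < b \<Longrightarrow> b \<le> m i \<Longrightarrow> 1 + (\<Sum>j<i. s j (m j)) \<le> s i b - s i a"
begin

text \<open>The number of levels of column \<open>i\<close>. The last copy inside column
  \<open>i + 1\<close> reaches the top of that column, so the height grows by exactly the largest
  offset, and all spacers lie between copies.\<close>

definition height :: "nat \<Rightarrow> int" where
  "height i = 1 + (\<Sum>j<i. s j (m j))"

definition offset :: "nat \<Rightarrow> (nat \<Rightarrow> nat) \<Rightarrow> int" where
  "offset N x = (\<Sum>i<N. s i (x i))"

definition digits :: "(nat \<Rightarrow> nat) set" where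
  "digits = {x. \<forall>i. x i \<le> m i}"

text \<open>Infinitely many non-maximal and nonzero digits make every carry and borrow stop. Both
  conditions survive a change of finitely many digits, so the set is closed under the odometer and
  its inverse.\<close>

definition generic :: "(nat \<Rightarrow> nat) set" where
  "generic = {x \<in> digits. (\<forall>N. \<exists>i\<ge>N. x i < m i) \<and> (\<forall>N. \<exists>i\<ge>N. 0 < x i)}"

text \<open>The odometer, with the carry running to the right. The all-maximal sequence wraps around
  to zero, so \<open>succ\<close> and \<open>pred\<close> are mutually inverse on the whole of
  \<open>digits\<close>, not only on \<open>generic\<close>.\<close>

definition succ :: "(nat \<Rightarrow> nat) \<Rightarrow> nat \<Rightarrow> nat" where
  "succ x i = (if \<forall>j<i. x j = m j then if x i = m i then 0 else x i + 1 else x i)"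

definition pred :: "(nat \<Rightarrow> nat) \<Rightarrow> nat \<Rightarrow> nat" where
  "pred x i = (if \<forall>j<i. x j = 0 then if x i = 0 then m i else x i - 1 else x i)"

definition carry :: "(nat \<Rightarrow> nat) \<Rightarrow> nat" where
  "carry x = (LEAST j. x j \<noteq> m j)"

text \<open>Below the carry all digits are maximal, so the point lies on the top level of its copy
  of column \<open>carry x\<close>, which is \<open>height - 1\<close> above the bottom of that
  copy. What remains of the way to the next copy is one plus the number of spacers.\<close>

definition return_time :: "(nat \<Rightarrow> nat) \<Rightarrow> nat" where
  "return_time x = nat (s (carry x) (x (carry x) + 1) - s (carry x) (x (carry x)) - (height (carry x) - 1))"

definition tower :: "((nat \<Rightarrow> nat) \<times> nat) set" where
  "tower = {(x, k). x \<in> generic \<and> k < return_time x}"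

definition step :: "(nat \<Rightarrow> nat) \<times> nat \<Rightarrow> (nat \<Rightarrow> nat) \<times> nat" where
  "step p = (if p \<in> tower
     then if snd p + 1 < return_time (fst p) then (fst p, snd p + 1) else (succ (fst p), 0)
     else p)"

definition unstep :: "(nat \<Rightarrow> nat) \<times> nat \<Rightarrow> (nat \<Rightarrow> nat) \<times> nat" where
  "unstep p = (if p \<in> tower
     then if 0 < snd p then (fst p, snd p - 1) else (pred (fst p), return_time (pred (fst p)) - 1)
     else p)"

text \<open>The orbit relation together with its time cocycle: equal tails, and a total level that
  grows by \<open>n\<close>. The value does not depend on the stage \<open>N\<close> beyond which
  the tails agree. It gives the time between two points without iterating
  \<open>step\<close>.\<close>

definition displaced :: "int \<Rightarrow> (nat \<Rightarrow> nat) \<times> nat \<Rightarrow> (nat \<Rightarrow> nat) \<times> nat \<Rightarrow> bool" where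
  "displaced n p p' \<longleftrightarrow> (\<exists>N. (\<forall>i\<ge>N. fst p i = fst p' i) \<and>
     int (snd p') + offset N (fst p') = int (snd p) + offset N (fst p) + n)"

section \<open>Ordering by offsets\<close>

lemma height_pos: "1 \<le> height i"
proof -
  have "0 \<le> s j (m j)" for j
  proof (induction j rule: less_induct)
    case (less j)
    have "0 \<le> (\<Sum>l<j. s l (m l))" by (rule sum_nonneg) (use less in auto)
    with s_gap[of 0 "m j" j] m_pos[of j] show ?case by simp
  qed
  then show ?thesis unfolding height_def by (simp add: sum_nonneg)
qed

lemma gap: "a < b \<Longrightarrow> b \<le> m i \<Longrightarrow> height i \<le> s i b - s i a"
  using s_gap[of a b i] by (simp add: height_def)

lemma s_mono: "a \<le> b \<Longrightarrow> b \<le> m i \<Longrightarrow> s i a \<le> s i b"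
  using gap[of a b i] height_pos[of i] by (cases "a = b") auto

lemma s_nonneg: "a \<le> m i \<Longrightarrow> 0 \<le> s i a"
  using s_mono[of 0 a i] by simp

lemma digits_le: "x \<in> digits \<Longrightarrow> x i \<le> m i"
  by (simp add: digits_def)

lemma generic_digits: "x \<in> generic \<Longrightarrow> x \<in> digits"
  by (simp add: generic_def)

lemma offset_bounds:
  assumes "x \<in> digits"
  shows "0 \<le> offset N x" "offset N x \<le> height N - 1"
  using assms unfolding offset_def height_def
  by (auto intro!: sum_nonneg sum_mono s_nonneg s_mono simp: digits_def)

lemma offset_extend:
  assumes "\<And>i. N \<le> i \<Longrightarrow> x i = y i" "N \<le> N'"
  shows "offset N' y - offset N' x = offset N y - offset N x"
proof -
  have "{..<N'} = {..<N} \<union> {N..<N'}" using assms(2) by auto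
  then have "offset N' z = offset N z + (\<Sum>i=N..<N'. s i (z i))" for z
    unfolding offset_def by (simp add: sum.union_disjoint ivl_disj_int)
  moreover have "(\<Sum>i=N..<N'. s i (x i)) = (\<Sum>i=N..<N'. s i (y i))"
    by (rule sum.cong) (use assms in auto)
  ultimately show ?thesis by simp
qed

text \<open>The most significant differing digit decides, because a gap at that place exceeds
  everything that lower places can contribute.\<close>

lemma offset_less:
  assumes "x \<in> digits" "y \<in> digits" "j < N" "x j < y j" "\<And>i. j < i \<Longrightarrow> i < N \<Longrightarrow> x i = y i"
  shows "offset N x < offset N y"
proof -
  have split: "offset N z = offset j z + s j (z j) + (\<Sum>i=Suc j..<N. s i (z i))" for z
  proof -
    have "{..<N} = insert j ({..<j} \<union> {Suc j..<N})" using assms(3) by auto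
    moreover have "{..<j} \<inter> {Suc j..<N} = {}" by auto
    ultimately show ?thesis unfolding offset_def
      by (simp add: sum.union_disjoint)
  qed
  have "(\<Sum>i=Suc j..<N. s i (x i)) = (\<Sum>i=Suc j..<N. s i (y i))"
    by (rule sum.cong) (use assms in auto)
  moreover have "height j \<le> s j (y j) - s j (x j)"
    using assms by (intro gap) (auto simp: digits_def)
  ultimately show ?thesis
    using offset_bounds[OF assms(1), of j] offset_bounds[OF assms(2), of j]
    by (simp add: split)
qed

lemma top_difference:
  fixes x y :: "nat \<Rightarrow> nat"
  assumes "x \<noteq> y" "\<And>i. N \<le> i \<Longrightarrow> x i = y i"
  obtains j where "j < N" "x j \<noteq> y j" "\<And>i. j < i \<Longrightarrow> x i = y i"
proof -
  let ?D = "{i. x i \<noteq> y i}"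
  have sub: "?D \<subseteq> {..<N}"
  proof
    fix i assume "i \<in> ?D"
    then show "i \<in> {..<N}" using assms(2)[of i] by (cases "N \<le> i") auto
  qed
  then have fin: "finite ?D" by (rule finite_subset) auto
  moreover have "?D \<noteq> {}" using assms(1) by auto
  ultimately have max: "Max ?D \<in> ?D" by (rule Max_in)
  have eq: "x i = y i" if "Max ?D < i" for i
  proof (rule ccontr)
    assume "x i \<noteq> y i"
    with Max_ge[OF fin, of i] that show False by simp
  qed
  show ?thesis
  proof (rule that)
    show "Max ?D < N" using max sub by blast
    show "x (Max ?D) \<noteq> y (Max ?D)" using max by (rule CollectD)
    show "x i = y i" if "Max ?D < i" for i using that by (rule eq)
  qed
qed

section \<open>The odometer, its inverse and the return times\<close>

lemma carry:
  assumes "x \<in> generic"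
  shows "x (carry x) < m (carry x)" and "i < carry x \<Longrightarrow> x i = m i"
proof -
  obtain i where "x i < m i" using assms by (auto simp: generic_def)
  then have "x i \<noteq> m i" by simp
  then have "x (carry x) \<noteq> m (carry x)" unfolding carry_def by (rule LeastI)
  with assms show "x (carry x) < m (carry x)"
    using digits_le[OF generic_digits[OF assms], of "carry x"] by simp
  show "x i = m i" if "i < carry x" for i
    using not_less_Least that unfolding carry_def by blast
qed

lemma succ_eq:
  assumes "x \<in> generic"
  shows "succ x i = (if i < carry x then 0 else if i = carry x then x i + 1 else x i)"
  using carry[OF assms] unfolding succ_def by (auto simp: not_less)

lemma succ_digits: "x \<in> digits \<Longrightarrow> succ x \<in> digits"
  unfolding digits_def succ_def by (auto simp: Suc_le_eq le_neq_implies_less)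

lemma pred_digits: "x \<in> digits \<Longrightarrow> pred x \<in> digits"
  unfolding digits_def pred_def by (auto intro: le_trans[OF diff_le_self])

lemma pred_succ: "x \<in> digits \<Longrightarrow> pred (succ x) = x"
proof
  fix i assume x: "x \<in> digits"
  have *: "(\<forall>j<i. succ x j = 0) \<longleftrightarrow> (\<forall>j<i. x j = m j)" for i
  proof (induction i)
    case (Suc i)
    moreover have "succ x i = 0 \<longleftrightarrow> x i = m i" if "\<forall>j<i. x j = m j"
      using that by (simp add: succ_def)
    ultimately show ?case by (auto simp: All_less_Suc)
  qed simp
  show "pred (succ x) i = x i"
    unfolding pred_def * by (auto simp: succ_def)
qed

lemma succ_pred: "x \<in> digits \<Longrightarrow> succ (pred x) = x"
proof
  fix i assume x: "x \<in> digits"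
  have *: "(\<forall>j<i. pred x j = m j) \<longleftrightarrow> (\<forall>j<i. x j = 0)" for i
  proof (induction i)
    case (Suc i)
    have "x i \<le> m i" using x by (simp add: digits_def)
    then have "pred x i = m i \<longleftrightarrow> x i = 0" if "\<forall>j<i. x j = 0"
      using that by (auto simp: pred_def)
    with Suc show ?case by (auto simp: All_less_Suc)
  qed simp
  have "x i \<le> m i" using x by (simp add: digits_def)
  then show "succ (pred x) i = x i"
    unfolding succ_def * by (auto simp: pred_def)
qed

lemma succ_generic:
  assumes "x \<in> generic"
  shows "succ x \<in> generic"
proof -
  have tail: "succ x i = x i" if "carry x < i" for i
    using that by (simp add: succ_eq[OF assms])
  have "\<exists>i\<ge>N. succ x i < m i" "\<exists>i\<ge>N. 0 < succ x i" for N
  proof -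
    obtain i j where "max N (Suc (carry x)) \<le> i" "x i < m i" "max N (Suc (carry x)) \<le> j" "0 < x j"
      using assms unfolding generic_def by blast
    then show "\<exists>i\<ge>N. succ x i < m i" "\<exists>i\<ge>N. 0 < succ x i"
      by (metis Suc_le_eq max.bounded_iff tail)+
  qed
  with succ_digits[OF generic_digits[OF assms]] show ?thesis by (simp add: generic_def)
qed

lemma pred_generic:
  assumes "x \<in> generic"
  shows "pred x \<in> generic"
proof -
  obtain c where c: "0 < x c" using assms by (auto simp: generic_def)
  then have tail: "pred x i = x i" if "c < i" for i
    using that by (auto simp: pred_def)
  have "\<exists>i\<ge>N. pred x i < m i" "\<exists>i\<ge>N. 0 < pred x i" for N
  proof -
    obtain i j where "max N (Suc c) \<le> i" "x i < m i" "max N (Suc c) \<le> j" "0 < x j"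
      using assms unfolding generic_def by blast
    then show "\<exists>i\<ge>N. pred x i < m i" "\<exists>i\<ge>N. 0 < pred x i"
      by (metis Suc_le_eq max.bounded_iff tail)+
  qed
  with pred_digits[OF generic_digits[OF assms]] show ?thesis by (simp add: generic_def)
qed

lemma return_time:
  assumes "x \<in> generic"
  shows "0 < return_time x"
    and "carry x < N \<Longrightarrow> int (return_time x) = offset N (succ x) - offset N x"
proof -
  let ?j = "carry x"
  have "height ?j \<le> s ?j (x ?j + 1) - s ?j (x ?j)"
    by (rule gap) (use carry(1)[OF assms] in auto)
  then have int_rt: "int (return_time x) = s ?j (x ?j + 1) - s ?j (x ?j) - (height ?j - 1)"
    and "0 < return_time x"
    unfolding return_time_def by auto
  then show "0 < return_time x" by simp
  show "int (return_time x) = offset N (succ x) - offset N x" if "?j < N"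
  proof -
    have eq: "offset N (succ x) - offset N x = offset (Suc ?j) (succ x) - offset (Suc ?j) x"
      by (rule offset_extend) (use that in \<open>auto simp: succ_eq[OF assms]\<close>)
    have "offset ?j (succ x) = 0" "offset ?j x = height ?j - 1"
      unfolding offset_def height_def using carry(2)[OF assms]
      by (auto simp: succ_eq[OF assms])
    then have "offset (Suc ?j) (succ x) = s ?j (x ?j + 1)"
      "offset (Suc ?j) x = height ?j - 1 + s ?j (x ?j)"
      by (auto simp: offset_def succ_eq[OF assms])
    with eq int_rt show ?thesis by simp
  qed
qed

text \<open>\<open>succ x\<close> is the next point above \<open>x\<close> in its tail class. At the
  top difference \<open>j\<close> from \<open>y\<close>, a carry below \<open>j\<close> leaves digit
  \<open>j\<close> smaller than that of \<open>y\<close>. Otherwise the carry is at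
  \<open>j\<close>, because \<open>x j < y j \<le> m j\<close> stops it there; then
  \<open>succ x\<close> has zeros below \<open>j\<close> and at most \<open>y j\<close> at
  \<open>j\<close>.\<close>

lemma return_time_next:
  assumes "x \<in> generic" "y \<in> generic" "\<And>i. N \<le> i \<Longrightarrow> x i = y i" "carry x < N"
    and "offset N x < offset N y"
  shows "offset N x + int (return_time x) \<le> offset N y"
proof -
  have x: "x \<in> digits" and y: "y \<in> digits" using assms generic_digits by auto
  have "x \<noteq> y" using assms(5) by auto
  then obtain j where j: "j < N" "x j \<noteq> y j" "\<And>i. j < i \<Longrightarrow> x i = y i"
    using top_difference[of x y N] assms(3) by metis
  have less: "x j < y j"
  proof (rule ccontr)
    assume "\<not> x j < y j"
    then have "offset N y < offset N x"
      using j by (intro offset_less[OF y x, of j]) auto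
    with assms(5) show False by simp
  qed
  have "offset N (succ x) \<le> offset N y"
  proof (cases "carry x < j")
    case True
    then have "offset N (succ x) < offset N y"
      using j less by (intro offset_less[of _ _ j] succ_digits x y) (auto simp: succ_eq[OF assms(1)])
    then show ?thesis by simp
  next
    case False
    then have "carry x = j"
      using carry(2)[OF assms(1), of j] less digits_le[OF y, of j] by (cases "carry x = j") auto
    then show ?thesis unfolding offset_def
      using j less by (intro sum_mono s_mono digits_le[OF y]) (auto simp: succ_eq[OF assms(1)])
  qed
  with return_time(2)[OF assms(1,4)] show ?thesis by simp
qed

section \<open>Orbits as tail classes with a time\<close>

lemma displaced_trans: "displaced a p p' \<Longrightarrow> displaced b p' p'' \<Longrightarrow> displaced (a + b) p p''"
proof -
  assume "displaced a p p'" "displaced b p' p''"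
  then obtain N N' where N: "\<forall>i\<ge>N. fst p i = fst p' i" "\<forall>i\<ge>N'. fst p' i = fst p'' i"
    and eq: "int (snd p') + offset N (fst p') = int (snd p) + offset N (fst p) + a"
       "int (snd p'') + offset N' (fst p'') = int (snd p') + offset N' (fst p') + b"
    unfolding displaced_def by auto
  let ?K = "max N N'"
  have "offset ?K (fst p') - offset ?K (fst p) = offset N (fst p') - offset N (fst p)"
    by (rule offset_extend) (use N in auto)
  moreover have "offset ?K (fst p'') - offset ?K (fst p') = offset N' (fst p'') - offset N' (fst p')"
    by (rule offset_extend) (use N in auto)
  ultimately have "int (snd p'') + offset ?K (fst p'') = int (snd p) + offset ?K (fst p) + (a + b)"
    using eq by linarith
  moreover have "\<forall>i\<ge>?K. fst p i = fst p'' i" using N by simp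
  ultimately show ?thesis unfolding displaced_def by blast
qed

lemma displaced_sym: "displaced n p p' \<Longrightarrow> displaced (- n) p' p"
  unfolding displaced_def by force

text \<open>Within a tail class the intervals from \<open>offset K x\<close> of length
  \<open>return_time x\<close> are disjoint, so the total level determines the base point, and then
  the floor.\<close>

lemma displaced_unique:
  assumes "p \<in> tower" "p' \<in> tower" "displaced 0 p p'"
  shows "p = p'"
proof -
  obtain x k y l where p: "p = (x, k)" "p' = (y, l)" by (meson surj_pair)
  from assms p have x: "x \<in> generic" "k < return_time x" and y: "y \<in> generic" "l < return_time y"
    by (auto simp: tower_def)
  from assms(3) p obtain N where N: "\<forall>i\<ge>N. x i = y i" "int l + offset N y = int k + offset N x"
    by (auto simp: displaced_def)
  define K where "K = max N (max (Suc (carry x)) (Suc (carry y)))"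
  have K: "\<And>i. K \<le> i \<Longrightarrow> x i = y i" "carry x < K" "carry y < K" "N \<le> K" using N by (auto simp: K_def)
  have "offset K y - offset K x = offset N y - offset N x"
    using N K by (intro offset_extend) auto
  with N have eq: "int l + offset K y = int k + offset K x" by simp
  have "\<not> offset K x < offset K y"
  proof
    assume "offset K x < offset K y"
    from return_time_next[OF x(1) y(1) K(1) K(2) this] eq x(2) show False by simp
  qed
  moreover have "\<not> offset K y < offset K x"
  proof
    assume "offset K y < offset K x"
    from return_time_next[OF y(1) x(1) K(1)[symmetric] K(3) this] eq y(2) show False by simp
  qed
  ultimately have off: "offset K x = offset K y" by simp
  have "x = y"
  proof (rule ccontr)
    assume "x \<noteq> y"
    then obtain j where j: "j < K" "x j \<noteq> y j" "\<And>i. j < i \<Longrightarrow> x i = y i"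
      using top_difference[of x y K] K(1) by metis
    then have "x j < y j \<or> y j < x j" by auto
    then show False
      using offset_less[of x y j K] offset_less[of y x j K] j off x(1) y(1) generic_digits by auto
  qed
  with eq off p show ?thesis by simp
qed

lemma tower_zero: "x \<in> generic \<Longrightarrow> (x, 0) \<in> tower"
  using return_time(1) by (auto simp: tower_def)

lemma step_tower: "p \<in> tower \<Longrightarrow> step p \<in> tower"
  using tower_zero succ_generic by (auto simp: step_def tower_def split: prod.splits)

lemma unstep_tower: "p \<in> tower \<Longrightarrow> unstep p \<in> tower"
  using return_time(1) pred_generic by (auto simp: unstep_def tower_def split: prod.splits)

lemma unstep_step: "unstep (step p) = p"
proof (cases "p \<in> tower")
  case True
  then obtain x k where p: "p = (x, k)" "x \<in> generic" "k < return_time x" by (auto simp: tower_def)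
  with step_tower[OF True] show ?thesis
    by (auto simp: unstep_def step_def tower_def pred_succ generic_digits)
qed (simp add: unstep_def step_def)

lemma step_unstep: "step (unstep p) = p"
proof (cases "p \<in> tower")
  case True
  then obtain x k where p: "p = (x, k)" "x \<in> generic" "k < return_time x" by (auto simp: tower_def)
  with unstep_tower[OF True] return_time(1)[OF pred_generic[OF p(2)]] show ?thesis
    by (auto simp: unstep_def step_def tower_def succ_pred generic_digits)
qed (simp add: unstep_def step_def)

lemma displaced_step:
  assumes "p \<in> tower"
  shows "displaced 1 p (step p)"
proof -
  obtain x k where p: "p = (x, k)" "x \<in> generic" "k < return_time x"
    using assms by (auto simp: tower_def)
  show ?thesis
  proof (cases "k + 1 < return_time x")
    case True
    with p assms show ?thesis by (simp add: displaced_def step_def)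
  next
    case False
    then have "step p = (succ x, 0)" "return_time x = k + 1" using p assms by (auto simp: step_def)
    with return_time(2)[OF p(2), of "Suc (carry x)"] p(1) show ?thesis
      unfolding displaced_def
      by (intro exI[of _ "Suc (carry x)"]) (auto simp: succ_eq[OF p(2)])
  qed
qed

lemma displaced_funpow:
  assumes "p \<in> tower"
  shows "(step ^^ n) p \<in> tower \<and> displaced (int n) p ((step ^^ n) p)"
proof (induction n)
  case (Suc n)
  with displaced_trans[OF _ displaced_step, of "int n" p "(step ^^ n) p"] step_tower
  show ?case by (simp add: add.commute)
qed (use assms in \<open>simp add: displaced_def\<close>)

text \<open>Turns arithmetic of offsets into a statement about iterates: no orbit has to be
  followed, it is enough to exhibit an end point with the right displacement.\<close>

lemma funpow_step_eq:
  assumes "p \<in> tower" "p' \<in> tower" "displaced (int n) p p'"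
  shows "(step ^^ n) p = p'"
proof (rule displaced_unique)
  show "displaced 0 ((step ^^ n) p) p'"
    using displaced_trans[OF displaced_sym assms(3)] displaced_funpow[OF assms(1), of n] by fastforce
qed (use assms displaced_funpow in auto)

section \<open>The digit measure and its symmetries\<close>

text \<open>Independent uniform digits. The factors live on all of \<open>nat\<close>, so the
  underlying type carries its usual Borel structure, and \<open>digits\<close> is merely a set of
  full measure.\<close>

definition dice :: "(nat \<Rightarrow> nat) measure" where
  "dice = Pi\<^sub>M UNIV (\<lambda>i. measure_pmf (pmf_of_set {..m i}))"

lemma product_prob_space_dice: "product_prob_space (\<lambda>i. measure_pmf (pmf_of_set {..m i}))"
  by unfold_locales

sublocale dice: prob_space dice
  unfolding dice_def by (intro prob_space_PiM) unfold_locales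

lemma space_dice [simp]: "space dice = UNIV"
  by (simp add: dice_def space_PiM)

lemma sets_dice: "sets dice = sets borel"
proof -
  have "sets dice = sets (Pi\<^sub>M UNIV (\<lambda>i::nat. borel :: nat measure))"
    unfolding dice_def by (rule sets_PiM_cong) (auto simp: sets_borel_eq_count_space)
  then show ?thesis by (simp add: sets_PiM_equal_borel)
qed

lemma measurable_digit [measurable]: "(\<lambda>x. x i) \<in> measurable dice (count_space UNIV)"
proof -
  have "(\<lambda>x. x i) \<in> measurable dice (measure_pmf (pmf_of_set {..m i}))"
    unfolding dice_def by (rule measurable_component_singleton) simp
  then show ?thesis by simp
qed

lemma measurable_diceI:
  assumes "\<And>i. (\<lambda>x. g x i) \<in> measurable N (count_space UNIV)"
  shows "g \<in> measurable N dice"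
  unfolding dice_def using assms by (intro measurable_abs_UNIV[of "\<lambda>i x. g x i", simplified]) simp

lemma measurable_prefix [measurable]:
  "(\<lambda>x. map x [0..<N]) \<in> measurable dice (count_space UNIV)"
proof (induction N)
  case (Suc N)
  have "(\<lambda>x. (\<lambda>l x. l @ [x N]) (map x [0..<N]) x) \<in> measurable dice (count_space UNIV)"
    by (rule measurable_compose_countable[OF _ Suc]) measurable
  then show ?case by simp
qed simp

lemma measure_box:
  assumes "finite J"
  shows "measure dice {x. \<forall>i\<in>J. x i \<in> A i} = (\<Prod>i\<in>J. real (card (A i \<inter> {..m i})) / real (m i + 1))"
proof -
  interpret D: product_prob_space "\<lambda>i. measure_pmf (pmf_of_set {..m i})" UNIV
    by (rule product_prob_space_dice)
  have "measure dice {x. \<forall>i\<in>J. x i \<in> A i} = (\<Prod>i\<in>J. measure (measure_pmf (pmf_of_set {..m i})) (A i))"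
  proof -
    have "prod_emb UNIV (\<lambda>i. measure_pmf (pmf_of_set {..m i})) J (Pi\<^sub>E J A) = {x. \<forall>i\<in>J. x i \<in> A i}"
      by (auto simp: prod_emb_def PiE_iff)
    then show ?thesis using D.measure_PiM_emb[of J A] assms by (simp add: dice_def)
  qed
  also have "\<dots> = (\<Prod>i\<in>J. real (card (A i \<inter> {..m i})) / real (m i + 1))"
    by (rule prod.cong) (auto simp: measure_pmf_of_set Int_commute)
  finally show ?thesis .
qed

lemma measure_digit:
  "measure dice {x. x i \<in> A} = real (card (A \<inter> {..m i})) / real (m i + 1)"
  using measure_box[of "{i}" "\<lambda>_. A"] by simp

section \<open>Finite words and cylinders\<close>

definition depends :: "nat \<Rightarrow> (nat \<Rightarrow> nat) set \<Rightarrow> bool" where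
  "depends N A \<longleftrightarrow> (\<forall>x y. (\<forall>i<N. x i = y i) \<longrightarrow> x \<in> A \<longrightarrow> y \<in> A)"

definition cyl :: "nat \<Rightarrow> (nat \<Rightarrow> nat) \<Rightarrow> (nat \<Rightarrow> nat) set" where
  "cyl N w = {x. \<forall>i<N. x i = w i}"

definition truncate :: "nat \<Rightarrow> (nat \<Rightarrow> nat) \<Rightarrow> nat \<Rightarrow> nat" where
  "truncate N x i = (if i < N then x i else 0)"

text \<open>Words of length \<open>N\<close> are padded with zeros to full sequences, so that
  \<open>offset\<close>, \<open>cyl\<close> and maps of sequences apply to them without
  conversion.\<close>

definition words :: "nat \<Rightarrow> (nat \<Rightarrow> nat) set" where
  "words N = PiE_dflt {..<N} 0 (\<lambda>i. {..m i})"

definition weight :: "nat \<Rightarrow> real" where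
  "weight N = (\<Prod>i<N. 1 / real (m i + 1))"

lemma finite_words: "finite (words N)"
  unfolding words_def by (rule finite_PiE_dflt) auto

lemma words_digits: "w \<in> words N \<Longrightarrow> w \<in> digits"
  by (auto simp: words_def PiE_dflt_def digits_def) (metis le0 linorder_not_le)

lemma truncate_words: "x \<in> digits \<Longrightarrow> truncate N x \<in> words N"
  by (auto simp: words_def PiE_dflt_def digits_def truncate_def)

lemma truncate_id: "w \<in> words N \<Longrightarrow> truncate N w = w"
  by (auto simp: words_def PiE_dflt_def truncate_def fun_eq_iff)

lemma truncate_cong: "(\<And>i. i < N \<Longrightarrow> x i = y i) \<Longrightarrow> truncate N x = truncate N y"
  by (auto simp: truncate_def)

lemma weight_pos: "0 < weight N"
  unfolding weight_def by (rule prod_pos) simp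

lemma dependsD: "depends N A \<Longrightarrow> (\<And>i. i < N \<Longrightarrow> x i = y i) \<Longrightarrow> x \<in> A \<longleftrightarrow> y \<in> A"
  unfolding depends_def by metis

lemma depends_cyl: "depends N (cyl N w)"
  by (auto simp: depends_def cyl_def)

lemma depends_mono: "depends N A \<Longrightarrow> N \<le> N' \<Longrightarrow> depends N' A"
  unfolding depends_def by (meson order_less_le_trans)

lemma depends_sets: "depends N A \<Longrightarrow> A \<in> sets dice"
proof -
  assume A: "depends N A"
  have "A = (\<lambda>x. map x [0..<N]) -` ((\<lambda>x. map x [0..<N]) ` A) \<inter> space dice"
  proof -
    have "x \<in> A" if "y \<in> A" "map x [0..<N] = map y [0..<N]" for x y
      using dependsD[OF A, of x y] that by simp
    then show ?thesis by auto
  qed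
  also have "\<dots> \<in> sets dice"
    by (rule measurable_sets[OF measurable_prefix]) simp
  finally show ?thesis .
qed

lemma cyl_sets [measurable]: "cyl N w \<in> sets dice"
  using depends_cyl depends_sets by blast

lemma digits_sets [measurable]: "digits \<in> sets dice"
proof -
  have "digits = {x\<in>space dice. \<forall>i. x i \<le> m i}" by (auto simp: digits_def)
  also have "\<dots> \<in> sets dice" by measurable
  finally show ?thesis .
qed

lemma AE_digits: "AE x in dice. x \<in> digits"
proof -
  have "AE x in dice. x i \<le> m i" for i
  proof (rule dice.AE_I_eq_1)
    show "emeasure dice {x \<in> space dice. x i \<le> m i} = 1"
      using measure_digit[of i "{..m i}"] by (simp add: dice.emeasure_eq_measure)
  qed measurable
  then show ?thesis by (simp add: digits_def AE_all_countable)
qed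

lemma measure_cyl:
  assumes "w \<in> digits"
  shows "measure dice (cyl N w) = weight N"
proof -
  have "cyl N w = {x. \<forall>i\<in>{..<N}. x i \<in> {w i}}" by (auto simp: cyl_def)
  then have "measure dice (cyl N w) = (\<Prod>i<N. real (card ({w i} \<inter> {..m i})) / real (m i + 1))"
    by (simp only: measure_box finite_lessThan)
  also have "\<dots> = weight N" unfolding weight_def
    using assms by (intro prod.cong) (auto simp: digits_def)
  finally show ?thesis .
qed

lemma measure_depends:
  assumes "depends N A" and [measurable]: "B \<in> sets dice"
  shows "measure dice (A \<inter> B) = (\<Sum>w\<in>words N \<inter> A. measure dice (cyl N w \<inter> B))"
proof -
  have [measurable]: "A \<in> sets dice" using assms depends_sets by blast
  have "measure dice (A \<inter> B) = measure dice (\<Union>w\<in>words N \<inter> A. cyl N w \<inter> B)"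
  proof (rule measure_eq_AE)
    show "AE x in dice. (x \<in> A \<inter> B) = (x \<in> (\<Union>w\<in>words N \<inter> A. cyl N w \<inter> B))"
      using AE_digits
    proof eventually_elim
      fix x assume x: "x \<in> digits"
      have "x \<in> A \<longleftrightarrow> truncate N x \<in> A"
        by (rule dependsD[OF assms(1)]) (simp add: truncate_def)
      moreover have "x \<in> cyl N (truncate N x)" by (simp add: cyl_def truncate_def)
      moreover have "w \<in> A \<Longrightarrow> x \<in> cyl N w \<Longrightarrow> x \<in> A" for w
        using dependsD[OF assms(1), of x w] by (auto simp: cyl_def)
      ultimately show "(x \<in> A \<inter> B) = (x \<in> (\<Union>w\<in>words N \<inter> A. cyl N w \<inter> B))"
        using truncate_words[OF x] by blast
    qed
  qed (use finite_words in \<open>auto intro!: sets.finite_UN\<close>)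
  also have "\<dots> = (\<Sum>w\<in>words N \<inter> A. measure dice (cyl N w \<inter> B))"
  proof (rule dice.finite_measure_finite_Union)
    show "disjoint_family_on (\<lambda>w. cyl N w \<inter> B) (words N \<inter> A)"
    proof (clarsimp simp: disjoint_family_on_def)
      fix v w assume "v \<in> words N" "w \<in> words N" "v \<noteq> w"
      then have "\<exists>i<N. v i \<noteq> w i"
        using truncate_id truncate_cong by metis
      then show "cyl N v \<inter> B \<inter> (cyl N w \<inter> B) = {}" by (auto simp: cyl_def)
    qed
  qed (use finite_words in auto)
  finally show ?thesis .
qed

lemma measure_depends_card:
  assumes "depends N A"
  shows "measure dice A = weight N * real (card (words N \<inter> A))"
proof -
  have "measure dice A = (\<Sum>w\<in>words N \<inter> A. measure dice (cyl N w))"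
    using measure_depends[OF assms, of UNIV] sets.top[of dice] by simp
  also have "\<dots> = (\<Sum>w\<in>words N \<inter> A. weight N)"
    by (rule sum.cong) (auto simp: measure_cyl words_digits)
  finally show ?thesis by simp
qed

section \<open>Measure-preserving maps of digit sequences\<close>

lemma Int_stable_depends: "Int_stable {A. \<exists>N. depends N A}"
proof (rule Int_stableI)
  fix A B assume "A \<in> {A. \<exists>N. depends N A}" "B \<in> {A. \<exists>N. depends N A}"
  then obtain N N' where "depends N A" "depends N' B" by auto
  then have "depends (max N N') A" "depends (max N N') B"
    by (auto intro: depends_mono)
  then have "depends (max N N') (A \<inter> B)" unfolding depends_def by blast
  then show "A \<inter> B \<in> {A. \<exists>N. depends N A}" by auto
qed

lemma sets_dice_depends: "sets dice = sigma_sets UNIV {A. \<exists>N. depends N A}"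
proof
  have gen: "sets dice = sigma_sets UNIV {{f. f i \<in> A} | i A. True}"
    unfolding dice_def by (subst sets_PiM_single) simp
  show "sets dice \<subseteq> sigma_sets UNIV {A. \<exists>N. depends N A}"
    unfolding gen
  proof (rule sigma_sets_mono, safe)
    fix i and A :: "nat set"
    have "depends (Suc i) {f. f i \<in> A}" by (auto simp: depends_def)
    then show "{f. f i \<in> A} \<in> sigma_sets UNIV {A. \<exists>N. depends N A}" by blast
  qed
  show "sigma_sets UNIV {A. \<exists>N. depends N A} \<subseteq> sets dice"
  proof -
    have "{A. \<exists>N. depends N A} \<subseteq> sets dice" using depends_sets by blast
    then show ?thesis using sets.sigma_sets_subset[of _ dice] by simp
  qed
qed

text \<open>A map that computes digit \<open>n\<close> from the digits up to \<open>n\<close>, with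
  an inverse of the same kind, permutes the words of each length, and all words of one length have
  the same weight. The odometer and all digitwise permutations are covered at once.\<close>

lemma distr_causal:
  assumes [measurable]: "g \<in> measurable dice dice"
    and causal: "\<And>x y n. (\<And>i. i \<le> n \<Longrightarrow> x i = y i) \<Longrightarrow> g x n = g y n"
      "\<And>x y n. (\<And>i. i \<le> n \<Longrightarrow> x i = y i) \<Longrightarrow> g' x n = g' y n"
    and digits: "\<And>x. x \<in> digits \<Longrightarrow> g x \<in> digits" "\<And>x. x \<in> digits \<Longrightarrow> g' x \<in> digits"
    and inv: "\<And>x. x \<in> digits \<Longrightarrow> g' (g x) = x" "\<And>x. x \<in> digits \<Longrightarrow> g (g' x) = x"
  shows "distr dice dice g = dice"
proof (rule measure_eqI_generator_eq[OF Int_stable_depends, where \<Omega> = UNIV and A = "\<lambda>_. UNIV"])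
  fix A assume "A \<in> {A. \<exists>N. depends N A}"
  then obtain N where A: "depends N A" by auto
  have *: "truncate N (h x) = truncate N (h y)"
    if "\<And>x y n. (\<And>i. i \<le> n \<Longrightarrow> x i = y i) \<Longrightarrow> h x n = h y n" "\<And>i. i < N \<Longrightarrow> x i = y i"
    for h :: "(nat \<Rightarrow> nat) \<Rightarrow> nat \<Rightarrow> nat" and x y
    by (rule truncate_cong, rule that(1)) (use that(2) in auto)
  have in_A: "truncate N x \<in> A \<longleftrightarrow> x \<in> A" for x
    by (rule dependsD[OF A]) (simp add: truncate_def)
  have gA: "depends N (g -` A)"
    unfolding depends_def
  proof (intro allI impI)
    fix x y assume "\<forall>i<N. x i = y i" "x \<in> g -` A"
    then show "y \<in> g -` A"
      using *[of g x y, OF causal(1)] in_A[of "g x"] in_A[of "g y"] by auto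
  qed
  have "bij_betw (\<lambda>w. truncate N (g w)) (words N \<inter> g -` A) (words N \<inter> A)"
  proof (rule bij_betw_byWitness[where f' = "\<lambda>w. truncate N (g' w)"])
    show "\<forall>w\<in>words N \<inter> g -` A. truncate N (g' (truncate N (g w))) = w"
    proof
      fix w assume "w \<in> words N \<inter> g -` A"
      then have w: "w \<in> words N" by simp
      have "truncate N (g' (truncate N (g w))) = truncate N (g' (g w))"
        by (rule *[of g' "truncate N (g w)" "g w", OF causal(2)]) (auto simp: truncate_def)
      with w show "truncate N (g' (truncate N (g w))) = w"
        by (simp add: inv words_digits truncate_id)
    qed
    have g_g': "truncate N (g (truncate N (g' w))) = w" if "w \<in> words N" for w
    proof -
      have "truncate N (g (truncate N (g' w))) = truncate N (g (g' w))"
        by (rule *[of g "truncate N (g' w)" "g' w", OF causal(1)]) (auto simp: truncate_def)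
      with that show ?thesis by (simp add: inv words_digits truncate_id)
    qed
    then show "\<forall>w\<in>words N \<inter> A. truncate N (g (truncate N (g' w))) = w" by blast
    show "(\<lambda>w. truncate N (g w)) ` (words N \<inter> g -` A) \<subseteq> words N \<inter> A"
      using in_A by (auto intro!: truncate_words digits(1) dest: words_digits)
    show "(\<lambda>w. truncate N (g' w)) ` (words N \<inter> A) \<subseteq> words N \<inter> g -` A"
    proof (rule image_subsetI)
      fix w assume "w \<in> words N \<inter> A"
      then have w: "w \<in> words N" "w \<in> A" by auto
      have "truncate N (g' w) \<in> words N"
        using w by (intro truncate_words digits(2) words_digits)
      moreover have "g (truncate N (g' w)) \<in> A"
        using g_g'[OF w(1)] in_A[of "g (truncate N (g' w))"] w(2) by simp
      ultimately show "truncate N (g' w) \<in> words N \<inter> g -` A" by simp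
    qed
  qed
  then have "card (words N \<inter> g -` A) = card (words N \<inter> A)" by (rule bij_betw_same_card)
  then have "measure dice (g -` A) = measure dice A"
    by (simp add: measure_depends_card[OF A] measure_depends_card[OF gA])
  then show "emeasure (distr dice dice g) A = emeasure dice A"
    using depends_sets[OF A] by (simp add: emeasure_distr dice.emeasure_eq_measure)
qed (use sets_dice_depends dice.emeasure_space_1 in \<open>auto simp: emeasure_distr depends_def\<close>)

definition permute :: "(nat \<Rightarrow> nat \<Rightarrow> nat) \<Rightarrow> (nat \<Rightarrow> nat) \<Rightarrow> nat \<Rightarrow> nat" where
  "permute \<pi> x i = \<pi> i (x i)"

lemma measurable_permute [measurable]: "permute \<pi> \<in> measurable dice dice"
  by (rule measurable_diceI) (simp add: permute_def)

lemma permute_digits: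
  assumes "\<And>i. \<pi> i permutes {..m i}" "x \<in> digits"
  shows "permute \<pi> x \<in> digits"
  using assms permutes_in_image[of "\<pi> _" "{..m _}"] by (auto simp: digits_def permute_def)

lemma distr_permute:
  assumes "\<And>i. \<pi> i permutes {..m i}"
  shows "distr dice dice (permute \<pi>) = dice"
proof (rule distr_causal[where g' = "permute (\<lambda>i. inv (\<pi> i))"])
  have inv: "inv (\<pi> i) permutes {..m i}" for i using assms by (rule permutes_inv)
  show "permute (\<lambda>i. inv (\<pi> i)) x \<in> digits" if "x \<in> digits" for x
    using inv that by (rule permute_digits)
  show "permute (\<lambda>i. inv (\<pi> i)) (permute \<pi> x) = x" "permute \<pi> (permute (\<lambda>i. inv (\<pi> i)) x) = x" for x
    using permutes_inverses[OF assms] by (auto simp: permute_def fun_eq_iff)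
qed (use assms permute_digits in \<open>auto simp: permute_def\<close>)

lemma measure_permute:
  assumes "\<And>i. \<pi> i permutes {..m i}" "A \<in> sets dice"
  shows "measure dice (permute \<pi> -` A) = measure dice A"
  using measure_distr[OF measurable_permute[of \<pi>] assms(2)] by (simp add: distr_permute[OF assms(1)])

lemma measurable_succ [measurable]: "succ \<in> measurable dice dice"
  by (rule measurable_diceI) (unfold succ_def, measurable)

lemma measurable_pred [measurable]: "pred \<in> measurable dice dice"
  by (rule measurable_diceI) (unfold pred_def, measurable)

lemma distr_succ: "distr dice dice succ = dice"
proof (rule distr_causal[where g' = pred])
  fix x y :: "nat \<Rightarrow> nat" and n assume xy: "\<And>i. i \<le> n \<Longrightarrow> x i = y i"
  then have "x n = y n" "(\<forall>i<n. x i = c i) = (\<forall>i<n. y i = c i)" for c by auto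
  then show "succ x n = succ y n" "pred x n = pred y n" by (auto simp: succ_def pred_def)
qed (auto simp: succ_digits pred_digits succ_pred pred_succ)

section \<open>Approximation by cylinders\<close>

lemma approx_depends:
  assumes "A \<in> sets dice" "0 < \<epsilon>"
  obtains N B where "depends N B" "measure dice (A - B) + measure dice (B - A) < \<epsilon>"
proof -
  have "A \<in> sigma_sets UNIV {A. \<exists>N. depends N A}" using assms(1) sets_dice_depends by simp
  then have "\<forall>\<epsilon>>0. \<exists>N B. depends N B \<and> measure dice (A - B) + measure dice (B - A) < \<epsilon>"
  proof (induction rule: sigma_sets.induct)
    case (Basic A)
    then obtain N where "depends N A" by blast
    then have "depends N A \<and> measure dice (A - A) + measure dice (A - A) < \<epsilon>" if "0 < \<epsilon>" for \<epsilon>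
      using that by simp
    then show ?case by blast
  next
    case Empty
    have "depends 0 {} \<and> measure dice ({} - {}) + measure dice ({} - {}) < \<epsilon>" if "0 < \<epsilon>" for \<epsilon>
      using that by (simp add: depends_def)
    then show ?case by blast
  next
    case (Compl A)
    show ?case
    proof (intro allI impI)
      fix \<epsilon> :: real assume "0 < \<epsilon>"
      with Compl obtain N B where B: "depends N B" "measure dice (A - B) + measure dice (B - A) < \<epsilon>"
        by blast
      have "UNIV - A - (UNIV - B) = B - A" "UNIV - B - (UNIV - A) = A - B" by auto
      with B have "measure dice (UNIV - A - (UNIV - B)) + measure dice (UNIV - B - (UNIV - A)) < \<epsilon>"
        by simp
      moreover have "depends N (UNIV - B)" unfolding depends_def
        using dependsD[OF B(1)] by blast
      ultimately show "\<exists>N B. depends N B \<and> measure dice (UNIV - A - B) + measure dice (B - (UNIV - A)) < \<epsilon>"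
        by blast
    qed
  next
    case (Union A)
    show ?case
    proof (intro allI impI)
      fix \<epsilon> :: real assume \<epsilon>: "0 < \<epsilon>"
      have A [measurable]: "A i \<in> sets dice" for i using Union(1) sets_dice_depends by simp
      let ?U = "\<Union>i. A i" and ?V = "\<lambda>n. \<Union>i<n. A i"
      have "(\<lambda>n. measure dice (?V n)) \<longlonglongrightarrow> measure dice (\<Union>n. ?V n)"
        by (rule dice.finite_Lim_measure_incseq) (auto intro!: incseq_SucI simp: lessThan_Suc)
      moreover have "(\<Union>n. ?V n) = ?U" by auto
      ultimately have "eventually (\<lambda>n. measure dice ?U - \<epsilon> / 2 < measure dice (?V n)) sequentially"
        using \<epsilon> by (intro order_tendstoD(1)) auto
      then obtain n where n: "measure dice ?U - \<epsilon> / 2 < measure dice (?V n)"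
        by (auto simp: eventually_sequentially)
      have "measure dice (?U - ?V n) = measure dice ?U - measure dice (?V n)"
        by (rule dice.finite_measure_Diff) auto
      with n have tail: "measure dice (?U - ?V n) < \<epsilon> / 2" by simp
      \<comment> \<open>One half of the error is spent on the tail of the union; the other half is
        shared by \<open>n\<close> sets, and the \<open>+ 1\<close> keeps \<open>\<delta>\<close>
        positive for \<open>n = 0\<close>.\<close>
      define \<delta> where "\<delta> = \<epsilon> / (2 * (real n + 1))"
      have "0 < \<delta>" using \<epsilon> by (simp add: \<delta>_def)
      with Union.IH have "\<forall>i. \<exists>N B. depends N B \<and> measure dice (A i - B) + measure dice (B - A i) < \<delta>"
        by blast
      then obtain N B where B: "\<And>i. depends (N i) (B i)"
        "\<And>i. measure dice (A i - B i) + measure dice (B i - A i) < \<delta>" by metis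
      have [measurable]: "B i \<in> sets dice" for i using depends_sets[OF B(1)] .
      let ?B = "\<Union>i<n. B i" and ?N = "\<Sum>i<n. N i"
      have "depends ?N (B i)" if "i < n" for i
        using that by (intro depends_mono[OF B(1)] member_le_sum) auto
      then have dep: "depends ?N ?B"
        unfolding depends_def by blast
      have "measure dice (?U - ?B) \<le> measure dice ((?U - ?V n) \<union> (\<Union>i<n. A i - B i))"
        by (rule dice.finite_measure_mono) auto
      also have "\<dots> \<le> measure dice (?U - ?V n) + measure dice (\<Union>i<n. A i - B i)"
        by (rule measure_Un_le) auto
      also have "measure dice (\<Union>i<n. A i - B i) \<le> (\<Sum>i<n. measure dice (A i - B i))"
        by (rule measure_UNION_le) auto
      finally have 1: "measure dice (?U - ?B) \<le> measure dice (?U - ?V n) + (\<Sum>i<n. measure dice (A i - B i))"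
        by simp
      have "measure dice (?B - ?U) \<le> measure dice (\<Union>i<n. B i - A i)"
        by (rule dice.finite_measure_mono) auto
      also have "\<dots> \<le> (\<Sum>i<n. measure dice (B i - A i))"
        by (rule measure_UNION_le) auto
      finally have "measure dice (?U - ?B) + measure dice (?B - ?U)
          \<le> measure dice (?U - ?V n) + (\<Sum>i<n. measure dice (A i - B i) + measure dice (B i - A i))"
        using 1 by (simp add: sum.distrib)
      also have "(\<Sum>i<n. measure dice (A i - B i) + measure dice (B i - A i)) \<le> (\<Sum>i<n. \<delta>)"
        by (rule sum_mono) (use B(2) in \<open>simp add: less_imp_le\<close>)
      also have "(\<Sum>i<n. \<delta>) \<le> \<epsilon> / 2" using \<epsilon> by (simp add: \<delta>_def field_simps)
      finally have "measure dice (?U - ?B) + measure dice (?B - ?U) < \<epsilon>" using tail by simp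
      with dep show "\<exists>N B. depends N B \<and> measure dice (?U - B) + measure dice (B - ?U) < \<epsilon>" by blast
    qed
  qed
  with assms(2) that show ?thesis by blast
qed

text \<open>The intersection exceeds \<open>4 * measure dice (B - A)\<close>, so the density of
  \<open>A\<close> in \<open>B\<close> is even above 4/5. Two thirds is the threshold of the
  argument with three special digits, and two such densities in one cylinder force an
  overlap.\<close>

lemma approx_not_two_thirds:
  assumes [measurable]: "A \<in> sets dice" "B \<in> sets dice"
    and "measure dice (A - B) + measure dice (B - A) < measure dice A / 4"
  shows "2 / 3 * measure dice B < measure dice (B \<inter> A)"
proof -
  have "measure dice A = measure dice (A - B) + measure dice (B \<inter> A)"
    using dice.finite_measure_Diff'[of A B] by (simp add: Int_commute)
  moreover have "measure dice B = measure dice (B - A) + measure dice (B \<inter> A)"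
    using dice.finite_measure_Diff'[of B A] by simp
  ultimately show ?thesis
    using assms(3) measure_nonneg[of dice "A - B"] measure_nonneg[of dice "B - A"] by linarith
qed

lemma dense_word:
  assumes A: "A \<in> sets dice" and B: "depends N B"
    and approx: "measure dice (A - B) + measure dice (B - A) < measure dice A / 4"
  obtains w where "w \<in> words N" "2 / 3 * weight N < measure dice (cyl N w \<inter> A)"
proof (rule ccontr)
  assume "\<not> thesis"
  with that have le: "measure dice (cyl N w \<inter> A) \<le> 2 / 3 * weight N" if "w \<in> words N" for w
    using \<open>w \<in> words N\<close> not_le by blast
  have "measure dice (B \<inter> A) \<le> (\<Sum>w\<in>words N \<inter> B. 2 / 3 * weight N)"
    unfolding measure_depends[OF B A] by (rule sum_mono) (use le in auto)
  also have "\<dots> = 2 / 3 * measure dice B"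
    by (simp add: measure_depends_card[OF B])
  finally show False using approx_not_two_thirds[OF A depends_sets[OF B] approx] by simp
qed

text \<open>Ergodicity of the tail relation: choose a cylinder that is mostly in A and one of the same
  length that is mostly in B, and exchange their words.\<close>

lemma exchange_words:
  assumes [measurable]: "A \<in> sets dice" "B \<in> sets dice"
    and pos: "0 < measure dice A" "0 < measure dice B"
  obtains \<pi> N e C where "\<And>i. \<pi> i permutes {..m i}" "\<And>i. N \<le> i \<Longrightarrow> \<pi> i = id"
    "C \<in> sets dice" "0 < measure dice C" "C \<subseteq> A" "C \<subseteq> permute \<pi> -` B"
    "\<And>x. x \<in> C \<Longrightarrow> offset N (permute \<pi> x) - offset N x = e"
proof -
  obtain N1 A' where A': "depends N1 A'" "measure dice (A - A') + measure dice (A' - A) < measure dice A / 4"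
    using approx_depends[of A "measure dice A / 4"] pos by auto
  obtain N2 B' where B': "depends N2 B'" "measure dice (B - B') + measure dice (B' - B) < measure dice B / 4"
    using approx_depends[of B "measure dice B / 4"] pos by auto
  define N where "N = max N1 N2"
  obtain w where w: "w \<in> words N" "2 / 3 * weight N < measure dice (cyl N w \<inter> A)"
    using dense_word[OF _ depends_mono[OF A'(1)] A'(2), of N] by (auto simp: N_def)
  obtain v where v: "v \<in> words N" "2 / 3 * weight N < measure dice (cyl N v \<inter> B)"
    using dense_word[OF _ depends_mono[OF B'(1)] B'(2), of N] by (auto simp: N_def)
  define \<pi> where "\<pi> i = (if i < N then Transposition.transpose (w i) (v i) else id)" for i
  have perm: "\<pi> i permutes {..m i}" for i
    using words_digits[OF w(1)] words_digits[OF v(1)]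
    by (auto simp: \<pi>_def digits_def intro!: permutes_swap_id permutes_id)
  \<comment> \<open>The transpositions carry \<open>cyl N w\<close> to \<open>cyl N v\<close> and
    keep the tails. So \<open>?D\<close> is a copy of the dense part of \<open>B\<close> inside
    \<open>cyl N w\<close>, and two parts of relative measure above 2/3 meet in more than a
    third.\<close>
  let ?D = "permute \<pi> -` (cyl N v \<inter> B)"
  let ?C = "cyl N w \<inter> A \<inter> ?D"
  have D_sets [measurable]: "?D \<in> sets dice"
  proof -
    have "permute \<pi> -` (cyl N v \<inter> B) \<inter> space dice \<in> sets dice"
      by (rule measurable_sets[OF measurable_permute]) measurable
    then show ?thesis by (simp only: space_dice Int_UNIV_right)
  qed
  have D: "?D \<subseteq> cyl N w"
  proof
    fix x assume "x \<in> ?D"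
    then have "\<pi> i (x i) = v i" if "i < N" for i using that by (auto simp: cyl_def permute_def)
    then have "x i = w i" if "i < N" for i
      using that by (metis \<pi>_def transpose_apply_second transpose_eq_imp_eq transpose_involutory)
    then show "x \<in> cyl N w" by (simp add: cyl_def)
  qed
  have "measure dice ?D = measure dice (cyl N v \<inter> B)"
    by (rule measure_permute[OF perm]) measurable
  moreover have "measure dice ((cyl N w \<inter> A) \<union> ?D) \<le> measure dice (cyl N w)"
    by (rule dice.finite_measure_mono) (use D in auto)
  moreover have "measure dice (cyl N w) = weight N" using measure_cyl[OF words_digits[OF w(1)]] .
  moreover have "measure dice ((cyl N w \<inter> A) \<union> ?D)
      = measure dice (cyl N w \<inter> A) + measure dice ?D - measure dice ?C"
    by (rule measure_Un3; unfold dice.fmeasurable_eq_sets; measurable)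
  ultimately have "0 < measure dice ?C"
    using w(2) v(2) weight_pos[of N] by simp
  moreover have "offset N (permute \<pi> x) - offset N x = offset N v - offset N w" if "x \<in> ?C" for x
  proof -
    have "offset N (permute \<pi> x) = offset N v" "offset N x = offset N w"
      unfolding offset_def using that by (auto intro!: sum.cong simp: cyl_def)
    then show ?thesis by simp
  qed
  moreover have "?C \<in> sets dice" by (intro sets.Int cyl_sets D_sets assms)
  ultimately show ?thesis
    using perm by (intro that[of \<pi> N ?C]) (auto simp only: \<pi>_def not_less[symmetric] if_False)
qed

section \<open>Changing one digit\<close>

lemma measurable_upd [measurable]: "(\<lambda>x. x(i := v)) \<in> measurable dice dice"
proof (rule measurable_diceI)
  show "(\<lambda>x. (x(i := v)) j) \<in> measurable dice (count_space UNIV)" for j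
    by (cases "i = j") simp_all
qed

lemma measure_exchange_digit:
  assumes [measurable]: "A \<in> sets dice" and "u \<le> m i" "v \<le> m i"
  shows "measure dice {x. x i = u \<and> x(i := v) \<in> A} = measure dice {x \<in> A. x i = v}"
proof -
  define \<pi> where "\<pi> j = (if j = i then Transposition.transpose u v else id)" for j
  have perm: "\<pi> j permutes {..m j}" for j
    using assms by (auto simp: \<pi>_def intro!: permutes_swap_id permutes_id)
  have "permute \<pi> x = x(i := v)" if "x i = u" for x
    using that by (auto simp: permute_def \<pi>_def fun_eq_iff)
  moreover have "permute \<pi> x i = v \<longleftrightarrow> x i = u" for x
    by (simp add: permute_def \<pi>_def) (metis transpose_apply_second transpose_involutory)
  ultimately have "permute \<pi> -` {x \<in> A. x i = v} = {x. x i = u \<and> x(i := v) \<in> A}"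
    by auto
  moreover have "{x \<in> space dice. x \<in> A \<and> x i = v} \<in> sets dice" by measurable
  then have "{x \<in> A. x i = v} \<in> sets dice" by simp
  from measure_permute[OF perm this]
  have "measure dice (permute \<pi> -` {x \<in> A. x i = v}) = measure dice {x \<in> A. x i = v}" .
  ultimately show ?thesis by (simp only:)
qed

text \<open>The part of \<open>C\<close> with digit \<open>v\<close>, moved to digit
  \<open>u\<close>, meets the part already there in a null set. Both therefore fit side by side into
  the slice of \<open>Q\<close> with digit \<open>u\<close>, as \<open>Q\<close> ignores digit
  \<open>i\<close>.\<close>

lemma exchange_digit_null:
  assumes [measurable]: "C \<in> sets dice" "Q \<in> sets dice"
    and Q: "\<And>x v. x \<in> Q \<longleftrightarrow> x(i := v) \<in> Q"
    and uv: "u \<le> m i" "v \<le> m i"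
    and null: "measure dice {x \<in> C. x i = u \<and> x(i := v) \<in> C} = 0"
  shows "measure dice {x \<in> C \<inter> Q. x i = u} + measure dice {x \<in> C \<inter> Q. x i = v} \<le> measure dice {x \<in> Q. x i = u}"
proof -
  have sets [measurable]: "{x \<in> A. x i = w} \<in> sets dice" "{x. x i = w \<and> x(i := w') \<in> A} \<in> sets dice"
    if [measurable]: "A \<in> sets dice" for A w w'
  proof -
    have "{x \<in> space dice. x \<in> A \<and> x i = w} \<in> sets dice" by measurable
    then show "{x \<in> A. x i = w} \<in> sets dice" by simp
    have "{x \<in> space dice. x i = w \<and> x(i := w') \<in> A} \<in> sets dice" by measurable
    then show "{x. x i = w \<and> x(i := w') \<in> A} \<in> sets dice" by simp
  qed
  let ?a = "{x \<in> C \<inter> Q. x i = u}" and ?b = "{x. x i = u \<and> x(i := v) \<in> C \<inter> Q}"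
  have int: "{x \<in> C. x i = u \<and> x(i := v) \<in> C} = {x \<in> C. x i = u} \<inter> {x. x i = u \<and> x(i := v) \<in> C}" by auto
  then have [measurable]: "{x \<in> C. x i = u \<and> x(i := v) \<in> C} \<in> sets dice" by simp
  have "measure dice (?a \<inter> ?b) \<le> measure dice {x \<in> C. x i = u \<and> x(i := v) \<in> C}"
    by (rule dice.finite_measure_mono) auto
  then have "measure dice (?a \<inter> ?b) \<le> 0" by (simp only: null)
  then have "measure dice (?a \<inter> ?b) = 0" by (simp only: measure_le_0_iff)
  moreover have "measure dice (?a \<union> ?b) = measure dice ?a + measure dice ?b - measure dice (?a \<inter> ?b)"
    by (rule measure_Un3; unfold dice.fmeasurable_eq_sets; measurable)
  moreover have "measure dice (?a \<union> ?b) \<le> measure dice {x \<in> Q. x i = u}"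
    by (rule dice.finite_measure_mono) (use Q in auto)
  moreover have "measure dice ?b = measure dice {x \<in> C \<inter> Q. x i = v}"
    by (rule measure_exchange_digit) (use uv in auto)
  ultimately show ?thesis by simp
qed

text \<open>If every stage failed, the set would fill at most two thirds of the event that a given stage
  is the first one to show a special digit. These events exhaust the approximating set.\<close>

lemma simultaneous_exchange:
  assumes C [measurable]: "C \<in> sets dice" and pos: "0 < measure dice C"
    and le: "\<And>i. a i \<le> m i" "\<And>i. b i \<le> m i" "\<And>i. c i \<le> m i"
    and distinct: "\<And>i. a i \<noteq> b i" "\<And>i. a i \<noteq> c i" "\<And>i. b i \<noteq> c i"
    and hit: "\<And>N. measure dice {x. \<forall>i\<in>I. N \<le> i \<longrightarrow> x i \<notin> {a i, b i, c i}} = 0"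
  obtains i where "i \<in> I" "0 < measure dice {x \<in> C. x i = a i \<and> x(i := b i) \<in> C}"
    "0 < measure dice {x \<in> C. x i = b i \<and> x(i := c i) \<in> C}"
proof (rule ccontr)
  assume no: "\<not> thesis"
  obtain N B where B: "depends N B" and approx: "measure dice (C - B) + measure dice (B - C) < measure dice C / 4"
    using approx_depends[OF C, of "measure dice C / 4"] pos by auto
  have [measurable]: "B \<in> sets dice" using depends_sets[OF B] .
  define J where "J = {i \<in> I. N \<le> i}"
  define Q where "Q i = {x \<in> B. \<forall>j\<in>J. j < i \<longrightarrow> x j \<notin> {a j, b j, c j}}" for i
  define E where "E i = (if i \<in> J then {x \<in> Q i. x i \<in> {a i, b i, c i}} else {})" for i
  have Q_sets [measurable]: "Q i \<in> sets dice" for i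
  proof -
    have "depends i {x. \<forall>j\<in>J. j < i \<longrightarrow> x j \<notin> {a j, b j, c j}}" by (simp add: depends_def)
    then have "B \<inter> {x. \<forall>j\<in>J. j < i \<longrightarrow> x j \<notin> {a j, b j, c j}} \<in> sets dice"
      using depends_sets by auto
    moreover have "Q i = B \<inter> {x. \<forall>j\<in>J. j < i \<longrightarrow> x j \<notin> {a j, b j, c j}}"
      unfolding Q_def by blast
    ultimately show ?thesis by simp
  qed
  have sets [measurable]: "{x \<in> A. x i = w} \<in> sets dice" if [measurable]: "A \<in> sets dice" for A i w
  proof -
    have "{x \<in> space dice. x \<in> A \<and> x i = w} \<in> sets dice" by measurable
    then show "{x \<in> A. x i = w} \<in> sets dice" by simp
  qed
  have three: "measure dice {x \<in> A. x i \<in> {a i, b i, c i}} =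
      measure dice {x \<in> A. x i = a i} + measure dice {x \<in> A. x i = b i} + measure dice {x \<in> A. x i = c i}"
    if [measurable]: "A \<in> sets dice" for A i
  proof -
    have "{x \<in> A. x i \<in> {a i, b i, c i}} = ({x \<in> A. x i = a i} \<union> {x \<in> A. x i = b i}) \<union> {x \<in> A. x i = c i}"
      by auto
    then have "measure dice {x \<in> A. x i \<in> {a i, b i, c i}}
        = measure dice (({x \<in> A. x i = a i} \<union> {x \<in> A. x i = b i}) \<union> {x \<in> A. x i = c i})"
      by (rule arg_cong)
    also have "\<dots> = measure dice ({x \<in> A. x i = a i} \<union> {x \<in> A. x i = b i}) + measure dice {x \<in> A. x i = c i}"
      by (rule dice.finite_measure_Union) (use distinct[of i] in auto)
    also have "measure dice ({x \<in> A. x i = a i} \<union> {x \<in> A. x i = b i}) = measure dice {x \<in> A. x i = a i} + measure dice {x \<in> A. x i = b i}"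
      by (rule dice.finite_measure_Union) (use distinct[of i] in auto)
    finally show ?thesis .
  qed
  have E_sets [measurable]: "E i \<in> sets dice" for i
  proof -
    have "{x. x i \<in> {a i, b i, c i}} \<in> sets dice"
      by (rule depends_sets[of "Suc i"]) (simp add: depends_def)
    then have "Q i \<inter> {x. x i \<in> {a i, b i, c i}} \<in> sets dice" by (intro sets.Int Q_sets)
    moreover have "E i = (if i \<in> J then Q i \<inter> {x. x i \<in> {a i, b i, c i}} else {})"
      unfolding E_def by (simp only: Collect_conj_eq Collect_mem_eq)
    ultimately show ?thesis by simp
  qed
  have part: "measure dice (E i \<inter> C) \<le> 2 / 3 * measure dice (E i)" for i
  proof (cases "i \<in> J")
    case True
    then have i: "i \<in> I" "N \<le> i" by (auto simp: J_def)
    have inv: "x \<in> Q i \<longleftrightarrow> x(i := v) \<in> Q i" for x v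
    proof -
      have "x \<in> B \<longleftrightarrow> x(i := v) \<in> B" by (rule dependsD[OF B]) (use i in auto)
      then show ?thesis by (auto simp: Q_def)
    qed
    have eq: "measure dice {x \<in> Q i. x i = u} = measure dice {x \<in> Q i. x i = v}"
      if "u \<le> m i" "v \<le> m i" for u v
    proof -
      have "{x. x i = u \<and> x(i := v) \<in> Q i} = {x \<in> Q i. x i = u}" using inv by auto
      then show ?thesis using measure_exchange_digit[of "Q i" u i v] that by simp
    qed
    have le1: "measure dice {x \<in> C \<inter> Q i. x i = v} \<le> measure dice {x \<in> Q i. x i = v}" for v
      by (rule dice.finite_measure_mono) auto
    have "measure dice {x \<in> C. x i = a i \<and> x(i := b i) \<in> C} = 0 \<or>
        measure dice {x \<in> C. x i = b i \<and> x(i := c i) \<in> C} = 0"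
    proof (rule ccontr)
      assume "\<not> ?thesis"
      then have "0 < measure dice {x \<in> C. x i = a i \<and> x(i := b i) \<in> C}"
        "0 < measure dice {x \<in> C. x i = b i \<and> x(i := c i) \<in> C}"
        using zero_less_measure_iff by blast+
      from that[OF i(1) this] no show False by contradiction
    qed
    \<comment> \<open>The three slices of \<open>Q i\<close> have equal measure. By the failed
      exchange two neighbouring special digits share the room of one slice, and the third digit adds
      at most one more: two out of three.\<close>
    then have "measure dice {x \<in> C \<inter> Q i. x i = a i} + measure dice {x \<in> C \<inter> Q i. x i = b i}
        + measure dice {x \<in> C \<inter> Q i. x i = c i} \<le> 2 * measure dice {x \<in> Q i. x i = a i}"
    proof
      assume "measure dice {x \<in> C. x i = a i \<and> x(i := b i) \<in> C} = 0"
      from exchange_digit_null[OF C Q_sets inv le(1,2) this] le1[of "c i"] eq[OF le(3,1)]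
      show ?thesis by simp
    next
      assume "measure dice {x \<in> C. x i = b i \<and> x(i := c i) \<in> C} = 0"
      from exchange_digit_null[OF C Q_sets inv le(2,3) this] le1[of "a i"] eq[OF le(2,1)]
      show ?thesis by simp
    qed
    moreover have "E i \<inter> C = {x \<in> C \<inter> Q i. x i \<in> {a i, b i, c i}}" "E i = {x \<in> Q i. x i \<in> {a i, b i, c i}}"
      using True by (auto simp: E_def)
    ultimately show ?thesis
      using three[of "C \<inter> Q i" i] three[of "Q i" i] eq[OF le(2,1)] eq[OF le(3,1)] by simp
  qed (simp add: E_def)
  have disj: "disjoint_family E"
    unfolding disjoint_family_on_def
  proof (intro ballI impI)
    have "E i \<inter> E j = {}" if "i < j" for i j
      using that by (auto simp: E_def Q_def split: if_splits)
    then show "E i \<inter> E j = {}" if "i \<noteq> j" for i j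
      using that by (metis Int_commute nat_neq_iff)
  qed
  \<comment> \<open>The points that show no special digit at any stage of \<open>I\<close> from
    \<open>N\<close> on. They are null by \<open>hit\<close>, so the first stage with a special
    digit partitions \<open>B\<close> up to measure zero.\<close>
  let ?Z = "{x. \<forall>i\<in>I. N \<le> i \<longrightarrow> x i \<notin> {a i, b i, c i}}"
  have UE: "(\<Union>i. E i) \<union> (B \<inter> ?Z) = B"
  proof (rule set_eqI)
    fix x
    have "x \<in> (\<Union>i. E i)" if x: "x \<in> B" "x \<notin> ?Z"
    proof -
      let ?P = "\<lambda>i. i \<in> J \<and> x i \<in> {a i, b i, c i}"
      have "\<exists>i. ?P i" using x by (auto simp: J_def)
      then have "?P (LEAST i. ?P i)" by (rule LeastI_ex)
      moreover have "x j \<notin> {a j, b j, c j}" if "j \<in> J" "j < (LEAST i. ?P i)" for j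
        using not_less_Least[OF that(2)] that(1) by blast
      ultimately have "x \<in> E (LEAST i. ?P i)" using x by (simp add: E_def Q_def)
      then show ?thesis by blast
    qed
    moreover have "E i \<subseteq> B" for i by (auto simp: E_def Q_def)
    ultimately show "x \<in> (\<Union>i. E i) \<union> (B \<inter> ?Z) \<longleftrightarrow> x \<in> B" by blast
  qed
  have Z_sets [measurable]: "?Z \<in> sets dice"
  proof -
    have "{x. i \<in> I \<longrightarrow> N \<le> i \<longrightarrow> x i \<notin> {a i, b i, c i}} \<in> sets dice" for i
      by (rule depends_sets[of "Suc i"]) (simp add: depends_def)
    then have "(\<Inter>i. {x. i \<in> I \<longrightarrow> N \<le> i \<longrightarrow> x i \<notin> {a i, b i, c i}}) \<in> sets dice"
      by (intro sets.countable_INT) auto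
    moreover have "?Z = (\<Inter>i. {x. i \<in> I \<longrightarrow> N \<le> i \<longrightarrow> x i \<notin> {a i, b i, c i}})" by blast
    ultimately show ?thesis by simp
  qed
  have Z_null: "measure dice (A \<inter> ?Z) = 0" if [measurable]: "A \<in> sets dice" for A
  proof -
    have "measure dice (A \<inter> ?Z) \<le> measure dice ?Z" by (rule dice.finite_measure_mono[OF Int_lower2 Z_sets])
    then show ?thesis by (simp only: hit measure_le_0_iff)
  qed
  have split: "measure dice (B \<inter> A) = (\<Sum>i. measure dice (E i \<inter> A))"
    "summable (\<lambda>i. measure dice (E i \<inter> A))" if [measurable]: "A \<in> sets dice" for A
  proof -
    have sums: "(\<lambda>i. measure dice (E i \<inter> A)) sums measure dice (\<Union>i. E i \<inter> A)"
      using disj by (intro dice.finite_measure_UNION) (auto simp: disjoint_family_on_def)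
    have "B \<inter> A = (\<Union>i. E i \<inter> A) \<union> (B \<inter> A \<inter> ?Z)" using UE by blast
    then have "measure dice (B \<inter> A) \<le> measure dice (\<Union>i. E i \<inter> A) + measure dice (B \<inter> A \<inter> ?Z)"
      using measure_Un_le[of "\<Union>i. E i \<inter> A" dice "B \<inter> A \<inter> ?Z"] by simp
    moreover have "measure dice (\<Union>i. E i \<inter> A) \<le> measure dice (B \<inter> A)"
      using UE by (intro dice.finite_measure_mono) auto
    ultimately have "measure dice (B \<inter> A) = measure dice (\<Union>i. E i \<inter> A)"
      using Z_null[of "B \<inter> A"] by simp
    with sums show "measure dice (B \<inter> A) = (\<Sum>i. measure dice (E i \<inter> A))"
      "summable (\<lambda>i. measure dice (E i \<inter> A))" by (auto simp: sums_iff)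
  qed
  have top: "UNIV \<in> sets dice" using sets.top[of dice] by simp
  have "measure dice (B \<inter> C) \<le> (\<Sum>i. 2 / 3 * measure dice (E i))"
    unfolding split(1)[OF C] using split(2)[OF top]
    by (intro suminf_le part split(2) C) (auto intro!: summable_mult)
  also have "\<dots> = 2 / 3 * measure dice B"
    using suminf_mult[OF split(2)[OF top], of "2 / 3"] split(1)[OF top] by simp
  finally show False using approx_not_two_thirds[OF C _ approx] by simp
qed

section \<open>The invariant measure on the tower\<close>

lemma AE_not_eventually: "AE x in dice. \<exists>i\<ge>N. x i \<noteq> v i"
proof -
  let ?Z = "{x. \<forall>i\<ge>N. x i = v i}"
  have bound: "measure dice {x. \<forall>i\<in>{N..<N+n}. x i \<in> {v i}} \<le> (1 / 2) ^ n" for n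
  proof -
    have "measure dice {x. \<forall>i\<in>{N..<N+n}. x i \<in> {v i}}
        = (\<Prod>i\<in>{N..<N+n}. real (card ({v i} \<inter> {..m i})) / real (m i + 1))"
      by (rule measure_box) simp
    also have "\<dots> \<le> (\<Prod>i\<in>{N..<N+n}. 1 / 2)"
    proof (rule prod_mono)
      fix i
      have "card ({v i} \<inter> {..m i}) \<le> 1" using card_mono[of "{v i}" "{v i} \<inter> {..m i}"] by simp
      then have "real (card ({v i} \<inter> {..m i})) / real (m i + 1) \<le> 1 / 2"
        using m_pos[of i] by (intro frac_le) auto
      then show "0 \<le> real (card ({v i} \<inter> {..m i})) / real (m i + 1) \<and>
          real (card ({v i} \<inter> {..m i})) / real (m i + 1) \<le> 1 / 2" by simp
    qed
    finally show ?thesis by simp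
  qed
  have sets: "?Z \<in> sets dice"
  proof -
    have "{x. N \<le> i \<longrightarrow> x i = v i} \<in> sets dice" for i
      by (rule depends_sets[of "Suc i"]) (simp add: depends_def)
    then have "(\<Inter>i. {x. N \<le> i \<longrightarrow> x i = v i}) \<in> sets dice" by (intro sets.countable_INT) auto
    moreover have "?Z = (\<Inter>i. {x. N \<le> i \<longrightarrow> x i = v i})" by blast
    ultimately show ?thesis by simp
  qed
  have "measure dice ?Z \<le> (1 / 2) ^ n" for n
  proof -
    have "measure dice ?Z \<le> measure dice {x. \<forall>i\<in>{N..<N+n}. x i \<in> {v i}}"
      by (rule dice.finite_measure_mono, force, rule depends_sets[of "N + n"]) (simp add: depends_def)
    with bound[of n] show ?thesis by simp
  qed
  then have "measure dice ?Z \<le> 0"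
    by (intro LIMSEQ_le_const[OF LIMSEQ_realpow_zero[of "1/2"]]) auto
  then have "measure dice ?Z = 0" by (simp only: measure_le_0_iff)
  then have "?Z \<in> null_sets dice" using sets by (auto simp: null_sets_def dice.emeasure_eq_measure)
  then show ?thesis by (rule AE_I') auto
qed

lemma AE_generic: "AE x in dice. x \<in> generic"
proof -
  have "AE x in dice. \<forall>N. (\<exists>i\<ge>N. x i \<noteq> m i) \<and> (\<exists>i\<ge>N. x i \<noteq> 0)"
    using AE_not_eventually[of _ m] AE_not_eventually[of _ "\<lambda>_. 0"] by (simp add: AE_all_countable)
  with AE_digits show ?thesis
  proof eventually_elim
    fix x assume x: "x \<in> digits" "\<forall>N. (\<exists>i\<ge>N. x i \<noteq> m i) \<and> (\<exists>i\<ge>N. x i \<noteq> 0)"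
    have "x i \<noteq> m i \<Longrightarrow> x i < m i" "x i \<noteq> 0 \<Longrightarrow> 0 < x i" for i
      using digits_le[OF x(1), of i] by auto
    with x show "x \<in> generic" unfolding generic_def by blast
  qed
qed

lemma generic_sets [measurable]: "generic \<in> sets dice"
proof -
  have "generic = {x\<in>space dice. x \<in> digits \<and> (\<forall>N. \<exists>i. N \<le> i \<and> x i < m i) \<and> (\<forall>N. \<exists>i. N \<le> i \<and> 0 < x i)}"
    by (auto simp: generic_def)
  also have "\<dots> \<in> sets dice" by measurable
  finally show ?thesis .
qed

lemma measurable_return_time [measurable]: "return_time \<in> measurable dice (count_space UNIV)"
proof -
  have carry: "carry \<in> measurable dice (count_space UNIV)"
    unfolding carry_def by measurable
  have "(\<lambda>x. (\<lambda>j x. nat (s j (x j + 1) - s j (x j) - (height j - 1))) (carry x) x) \<in> measurable dice (count_space UNIV)"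
  proof (rule measurable_compose_countable[OF _ carry])
    show "(\<lambda>x. nat (s j (x j + 1) - s j (x j) - (height j - 1))) \<in> measurable dice (count_space UNIV)" for j
      using measurable_compose[OF measurable_digit[of j] measurable_count_space,
          of "\<lambda>v. nat (s j (v + 1) - s j v - (height j - 1))"] .
  qed
  then show ?thesis unfolding return_time_def[abs_def] .
qed

abbreviation base_measure :: "((nat \<Rightarrow> nat) \<times> nat) measure" where
  "base_measure \<equiv> dice \<Otimes>\<^sub>M count_space UNIV"

text \<open>A density instead of a subspace: \<open>step\<close> stays a bijection of the full
  product type, and everything off \<open>tower\<close> is null.\<close>

definition tower_measure :: "((nat \<Rightarrow> nat) \<times> nat) measure" where
  "tower_measure = density base_measure (indicator tower)"

definition slice :: "((nat \<Rightarrow> nat) \<times> nat) set \<Rightarrow> nat \<Rightarrow> (nat \<Rightarrow> nat) set" where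
  "slice A k = {x. (x, k) \<in> tower \<inter> A}"

lemma space_base [simp]: "space base_measure = UNIV"
  by (simp add: space_pair_measure)

lemma space_tower [simp]: "space tower_measure = UNIV"
  by (simp add: tower_measure_def)

lemma sets_tower [measurable_cong, simp]: "sets tower_measure = sets base_measure"
  by (simp add: tower_measure_def)

lemma sets_base: "sets base_measure = sets borel"
proof -
  have "sets base_measure = sets ((borel :: (nat \<Rightarrow> nat) measure) \<Otimes>\<^sub>M (borel :: nat measure))"
    by (rule sets_pair_measure_cong) (auto simp: sets_dice sets_borel_eq_count_space)
  then show ?thesis by (simp only: borel_prod)
qed

lemma measurable_level: "(\<lambda>x. (x, k)) \<in> measurable dice base_measure"
  by measurable

lemma tower_sets [measurable]: "tower \<in> sets base_measure"
proof -
  have "{p \<in> space base_measure. snd p < return_time (fst p)} \<in> sets base_measure"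
    by (rule measurable_less_nat) measurable
  then have "(fst -` generic \<inter> space base_measure) \<inter> {p \<in> space base_measure. snd p < return_time (fst p)}
      \<in> sets base_measure"
    by (intro sets.Int measurable_sets[OF measurable_fst generic_sets])
  moreover have "tower = (fst -` generic \<inter> space base_measure) \<inter>
      {p \<in> space base_measure. snd p < return_time (fst p)}"
    by (auto simp: tower_def)
  ultimately show ?thesis by simp
qed

lemma slice_sets [measurable]: "A \<in> sets base_measure \<Longrightarrow> slice A k \<in> sets dice"
  using measurable_sets[OF measurable_level, of "tower \<inter> A" k] by (simp add: slice_def vimage_def)

lemma emeasure_tower_base:
  "A \<in> sets base_measure \<Longrightarrow> emeasure tower_measure A = emeasure base_measure (tower \<inter> A)"
  unfolding tower_measure_def by (rule emeasure_restricted) auto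

lemma emeasure_tower:
  assumes "A \<in> sets base_measure"
  shows "emeasure tower_measure A = (\<Sum>k. emeasure dice (slice A k))"
proof -
  interpret pair_sigma_finite dice "count_space UNIV :: nat measure"
    by (simp add: pair_sigma_finite_def dice.sigma_finite_measure_axioms sigma_finite_measure_count_space)
  have "emeasure tower_measure A = (\<integral>\<^sup>+k. emeasure dice ((\<lambda>x. (x, k)) -` (tower \<inter> A)) \<partial>count_space UNIV)"
    unfolding emeasure_tower_base[OF assms]
    using assms tower_sets by (intro emeasure_pair_measure_alt2) auto
  then show ?thesis by (simp add: nn_integral_count_space_nat slice_def vimage_def)
qed

lemma emeasure_level_le: "emeasure tower_measure (UNIV \<times> {k}) \<le> 1"
proof -
  interpret sigma_finite_measure "count_space UNIV :: nat measure"
    by (rule sigma_finite_measure_count_space)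
  have top: "UNIV \<in> sets dice" using sets.top[of dice] by simp
  then have sets: "UNIV \<times> {k} \<in> sets base_measure" by auto
  then have "emeasure tower_measure (UNIV \<times> {k}) \<le> emeasure base_measure (UNIV \<times> {k})"
    by (simp add: emeasure_tower_base emeasure_mono)
  also have "\<dots> = emeasure dice UNIV * 1"
    using top by (subst emeasure_pair_measure_Times) auto
  finally show ?thesis using dice.emeasure_space_1 by simp
qed

lemma level_sets [measurable]: "UNIV \<times> {k} \<in> sets base_measure"
  using sets.top[of dice] by auto

lemma sigma_finite_tower: "sigma_finite_measure tower_measure"
proof
  show "\<exists>A. countable A \<and> A \<subseteq> sets tower_measure \<and> \<Union> A = space tower_measure \<and>
      (\<forall>a\<in>A. emeasure tower_measure a \<noteq> \<infinity>)"
  proof (intro exI[of _ "range (\<lambda>k. UNIV \<times> {k})"] conjI ballI)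
    show "emeasure tower_measure a \<noteq> \<infinity>" if "a \<in> range (\<lambda>k. UNIV \<times> {k})" for a
    proof -
      obtain k where "a = UNIV \<times> {k}" using \<open>a \<in> range _\<close> by blast
      then show ?thesis using le_less_trans[OF emeasure_level_le[of k] ennreal_one_less_top] by simp
    qed
  qed auto
qed

lemma measurable_step [measurable]: "step \<in> measurable base_measure base_measure"
proof -
  have "(\<lambda>p. if p \<in> tower
     then if snd p + 1 < return_time (fst p) then (fst p, snd p + 1) else (succ (fst p), 0)
     else p) \<in> measurable base_measure (dice \<Otimes>\<^sub>M count_space UNIV)"
  proof (intro measurable_If)
    show "{p \<in> space base_measure. p \<in> tower} \<in> sets base_measure" using tower_sets by simp
    show "{p \<in> space base_measure. snd p + 1 < return_time (fst p)} \<in> sets base_measure"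
      by (rule measurable_less_nat) measurable
    show "(\<lambda>p. (fst p, snd p + 1)) \<in> measurable base_measure base_measure"
      "(\<lambda>p. (succ (fst p), 0)) \<in> measurable base_measure base_measure"
      by measurable
  qed (rule measurable_ident_sets[OF refl])
  then show ?thesis by (simp add: step_def[abs_def])
qed

lemma measurable_unstep [measurable]: "unstep \<in> measurable base_measure base_measure"
proof -
  have "(\<lambda>p. if p \<in> tower
     then if 0 < snd p then (fst p, snd p - 1) else (pred (fst p), return_time (pred (fst p)) - 1)
     else p) \<in> measurable base_measure (dice \<Otimes>\<^sub>M count_space UNIV)"
  proof (intro measurable_If)
    show "{p \<in> space base_measure. p \<in> tower} \<in> sets base_measure" using tower_sets by simp
    show "{p \<in> space base_measure. 0 < snd p} \<in> sets base_measure"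
      by (rule measurable_less_nat) measurable
    show "(\<lambda>p. (fst p, snd p - 1)) \<in> measurable base_measure base_measure"
      "(\<lambda>p. (pred (fst p), return_time (pred (fst p)) - 1)) \<in> measurable base_measure base_measure"
      by measurable
  qed (rule measurable_ident_sets[OF refl])
  then show ?thesis by (simp add: unstep_def[abs_def])
qed

lemma vimage_sets: "f \<in> measurable base_measure base_measure \<Longrightarrow> A \<in> sets base_measure \<Longrightarrow> f -` A \<in> sets base_measure"
  using measurable_sets[of f base_measure base_measure A] by simp

text \<open>A point at floor \<open>k\<close> either moves up to floor \<open>k + 1\<close>, or is
  at its top floor and passes to the base through \<open>succ\<close>. The sets \<open>R k\<close>
  of the second kind partition, up to a null set, the \<open>succ\<close>-preimage of the base
  slice, and \<open>succ\<close> preserves \<open>dice\<close>; this restores the missing term for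
  floor 0.\<close>

lemma emeasure_step:
  assumes A: "A \<in> sets base_measure"
  shows "emeasure tower_measure (step -` A) = emeasure tower_measure A"
proof -
  define R where "R k = {x \<in> generic. return_time x = k + 1 \<and> succ x \<in> slice A 0}" for k
  have sA [measurable]: "slice A k \<in> sets dice" for k using A by measurable
  have R_sets [measurable]: "R k \<in> sets dice" for k
  proof -
    have "{x \<in> space dice. x \<in> generic \<and> return_time x = k + 1 \<and> succ x \<in> slice A 0} \<in> sets dice"
      by measurable
    then show ?thesis by (simp add: R_def)
  qed
  have slice: "slice (step -` A) k = slice A (k + 1) \<union> R k" for k
    using return_time(1) succ_generic tower_zero
    by (auto simp: slice_def tower_def step_def R_def split: if_splits)
  have "emeasure dice (slice (step -` A) k) = emeasure dice (slice A (k + 1)) + emeasure dice (R k)" for k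
    unfolding slice by (rule plus_emeasure[symmetric, OF sA R_sets]) (auto simp: slice_def tower_def R_def)
  then have "emeasure tower_measure (step -` A) = (\<Sum>k. emeasure dice (slice A (k + 1)) + emeasure dice (R k))"
    by (simp add: emeasure_tower vimage_sets[OF measurable_step A])
  also have "\<dots> = (\<Sum>k. emeasure dice (slice A (k + 1))) + (\<Sum>k. emeasure dice (R k))"
    by (rule suminf_add[symmetric]) auto
  also have "(\<Sum>k. emeasure dice (R k)) = emeasure dice (\<Union>k. R k)"
    by (rule suminf_emeasure) (auto simp: disjoint_family_on_def R_def)
  also have "emeasure dice (\<Union>k. R k) = emeasure dice (succ -` slice A 0 \<inter> space dice)"
  proof (rule emeasure_eq_AE)
    show "AE x in dice. x \<in> (\<Union>k. R k) \<longleftrightarrow> x \<in> succ -` slice A 0 \<inter> space dice"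
      using AE_generic
    proof eventually_elim
      fix x assume x: "x \<in> generic"
      then have "return_time x = (return_time x - 1) + 1" using return_time(1)[of x] by simp
      with x show "x \<in> (\<Union>k. R k) \<longleftrightarrow> x \<in> succ -` slice A 0 \<inter> space dice"
        unfolding R_def by auto
    qed
  qed measurable
  also have "\<dots> = emeasure (distr dice dice succ) (slice A 0)"
    by (rule emeasure_distr[symmetric]) measurable
  also have "\<dots> = emeasure dice (slice A 0)" by (simp add: distr_succ)
  also have "(\<Sum>k. emeasure dice (slice A (k + 1))) + emeasure dice (slice A 0) = emeasure tower_measure A"
    using suminf_offset[of "\<lambda>k. emeasure dice (slice A k)" 1] by (simp add: emeasure_tower[OF A])
  finally show ?thesis .
qed

text \<open>Up to null sets an atom would sit in a single floor and, for every \<open>N\<close>, in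
  a single cylinder of length \<open>N\<close>; such a piece has mass at most
  \<open>(1 / 2) ^ N\<close>.\<close>

lemma nonatomic_tower: "nonatomic tower_measure"
  unfolding nonatomic_def
proof
  assume "\<exists>A. measure_atom tower_measure A"
  then obtain A where A: "A \<in> sets base_measure" "0 < emeasure tower_measure A"
    and atom: "\<And>B. B \<in> sets base_measure \<Longrightarrow> B \<subseteq> A \<Longrightarrow>
      emeasure tower_measure B = 0 \<or> emeasure tower_measure (A - B) = 0"
    by (auto simp: measure_atom_def)
  have piece: "emeasure tower_measure B = emeasure tower_measure A"
    if "B \<in> sets base_measure" "B \<subseteq> A" "emeasure tower_measure B \<noteq> 0" for B
  proof -
    have "emeasure tower_measure A = emeasure tower_measure B + emeasure tower_measure (A - B)"
      using that A by (subst plus_emeasure) (auto intro!: arg_cong[of _ _ "emeasure tower_measure"])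
    with atom[OF that(1,2)] that(3) show ?thesis by simp
  qed
  have "\<exists>k. emeasure tower_measure (A \<inter> UNIV \<times> {k}) \<noteq> 0"
  proof (rule ccontr)
    assume "\<not> ?thesis"
    then have "(\<Union>k. A \<inter> UNIV \<times> {k}) \<in> null_sets tower_measure"
      using A by (intro null_sets_UN) (auto simp: null_sets_def)
    moreover have "(\<Union>k. A \<inter> UNIV \<times> {k}) = A" by auto
    ultimately show False using A(2) by auto
  qed
  then obtain k where k: "emeasure tower_measure (A \<inter> UNIV \<times> {k}) \<noteq> 0" by blast
  then have level: "emeasure tower_measure (A \<inter> UNIV \<times> {k}) = emeasure tower_measure A"
    using A by (intro piece) auto
  have half: "weight N \<le> (1 / 2) ^ N" for N
  proof -
    have "weight N \<le> (\<Prod>i<N. 1 / 2)" unfolding weight_def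
      using m_pos by (intro prod_mono) (auto simp: field_simps Suc_le_eq)
    then show ?thesis by simp
  qed
  have le: "emeasure tower_measure A \<le> ennreal ((1 / 2) ^ N)" for N
  proof -
    let ?P = "\<lambda>w. A \<inter> UNIV \<times> {k} \<inter> fst -` cyl N w"
    have P_sets: "?P w \<in> sets base_measure" for w
      using A measurable_sets[OF measurable_fst, of "cyl N w"] by auto
    have "\<exists>w\<in>words N. emeasure tower_measure (?P w) \<noteq> 0"
    proof (rule ccontr)
      assume "\<not> ?thesis"
      then have null: "(\<Union>w\<in>words N. ?P w) \<in> null_sets tower_measure"
        using P_sets finite_words by (intro null_sets.finite_UN) (auto simp: null_sets_def)
      have "A \<inter> UNIV \<times> {k} \<inter> tower \<subseteq> (\<Union>w\<in>words N. ?P w)"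
      proof
        fix p assume p: "p \<in> A \<inter> UNIV \<times> {k} \<inter> tower"
        then have "fst p \<in> digits" by (auto simp: tower_def generic_def)
        then have "truncate N (fst p) \<in> words N" by (rule truncate_words)
        moreover have "fst p \<in> cyl N (truncate N (fst p))" by (simp add: cyl_def truncate_def)
        ultimately show "p \<in> (\<Union>w\<in>words N. ?P w)" using p by blast
      qed
      then have "emeasure tower_measure (A \<inter> UNIV \<times> {k} \<inter> tower) = 0"
        using null by (metis emeasure_eq_0 null_setsD1 null_setsD2)
      moreover have "emeasure tower_measure (A \<inter> UNIV \<times> {k} \<inter> tower) = emeasure tower_measure (A \<inter> UNIV \<times> {k})"
        using A by (subst (1 2) emeasure_tower_base) (auto simp: Int_ac)
      ultimately show False using k by simp
    qed
    then obtain w where w: "w \<in> words N" "emeasure tower_measure (?P w) \<noteq> 0" by blast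
    have "emeasure tower_measure A = emeasure tower_measure (?P w)"
      by (rule piece[OF P_sets _ w(2), symmetric]) blast
    also have "\<dots> = (\<Sum>j. emeasure dice (slice (?P w) j))"
      using P_sets by (rule emeasure_tower)
    also have "\<dots> = (\<Sum>j\<in>{k}. emeasure dice (slice (?P w) j))"
      by (rule suminf_finite) (auto simp: slice_def)
    also have "\<dots> \<le> emeasure dice (cyl N w)"
      by (auto intro!: emeasure_mono simp: slice_def)
    also have "\<dots> = ennreal (weight N)"
      using w by (simp add: dice.emeasure_eq_measure measure_cyl words_digits)
    also have "\<dots> \<le> ennreal ((1 / 2) ^ N)" using half by (rule ennreal_leI)
    finally show ?thesis .
  qed
  have "(\<lambda>N. ennreal ((1 / 2) ^ N)) \<longlonglongrightarrow> ennreal 0"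
    by (intro tendsto_ennrealI LIMSEQ_realpow_zero) auto
  then have "emeasure tower_measure A \<le> ennreal 0"
    by (rule LIMSEQ_le_const) (use le in auto)
  with A(2) show False by simp
qed

text \<open>Above the top level of copy \<open>a\<close> of column \<open>j\<close> all points wait
  for the same number of spacers, so each of these floors carries at least the mass of a cylinder of
  length \<open>j + 1\<close>. The hypothesis says that such blocks of floors have unbounded
  mass.\<close>

lemma infinite_tower:
  assumes "\<And>K::real. \<exists>j a. a < m j \<and> K \<le> weight (Suc j) * real_of_int (s j (a + 1) - s j a - height j)"
  shows "emeasure tower_measure UNIV = \<infinity>"
proof -
  have "ennreal K \<le> emeasure tower_measure UNIV" for K
  proof -
    obtain j a where j: "a < m j" "K \<le> weight (Suc j) * real_of_int (s j (a + 1) - s j a - height j)"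
      using assms by blast
    \<comment> \<open>Maximal digits below \<open>j\<close> push the carry to \<open>j\<close>, and
      the digit \<open>a < m j\<close> stops it there.\<close>
    define w where "w i = (if i < j then m i else if i = j then a else 0)" for i
    define n where "n = nat (s j (a + 1) - s j a - height j)"
    have w: "w \<in> digits" using j by (auto simp: w_def digits_def)
    have "height j \<le> s j (a + 1) - s j a" by (rule gap) (use j in auto)
    then have n: "int n = s j (a + 1) - s j a - height j" by (simp add: n_def)
    have rt: "n < return_time x" if "x \<in> cyl (Suc j) w" for x
    proof -
      have x: "x i = w i" if "i \<le> j" for i using \<open>x \<in> cyl (Suc j) w\<close> that by (auto simp: cyl_def)
      have "carry x = j" unfolding carry_def
        by (rule Least_equality) (use x j in \<open>auto simp: w_def not_less[symmetric]\<close>)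
      with x[of j] n show ?thesis by (simp add: return_time_def w_def)
    qed
    have "ennreal (weight (Suc j)) \<le> emeasure dice (slice UNIV k)"
      if "k < n" for k
    proof -
      have "emeasure dice (cyl (Suc j) w) \<le> emeasure dice (slice UNIV k)"
      proof (rule emeasure_mono_AE)
        show "AE x in dice. x \<in> cyl (Suc j) w \<longrightarrow> x \<in> slice UNIV k"
          using AE_generic by eventually_elim (use rt that in \<open>force simp: slice_def tower_def\<close>)
        show "slice UNIV k \<in> sets dice" using sets.top[of base_measure] by (intro slice_sets) simp
      qed
      then show ?thesis using w by (simp add: dice.emeasure_eq_measure measure_cyl)
    qed
    then have "(\<Sum>k<n. ennreal (weight (Suc j))) \<le> (\<Sum>k<n. emeasure dice (slice UNIV k))"
      by (intro sum_mono) auto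
    also have "\<dots> \<le> (\<Sum>k. emeasure dice (slice UNIV k))"
      by (rule sum_le_suminf) auto
    also have "\<dots> = emeasure tower_measure UNIV"
      using sets.top[of base_measure] by (intro emeasure_tower[symmetric]) simp
    also have "(\<Sum>k<n. ennreal (weight (Suc j))) = ennreal (real n * weight (Suc j))"
      using weight_pos[of "Suc j"] by (simp add: ennreal_mult ennreal_of_nat_eq_real_of_nat)
    finally have le: "ennreal (real n * weight (Suc j)) \<le> emeasure tower_measure UNIV" .
    have "real n = real_of_int (s j (a + 1) - s j a - height j)" using n by linarith
    with j have "K \<le> real n * weight (Suc j)" by (simp add: mult.commute)
    then have "ennreal K \<le> ennreal (real n * weight (Suc j))" by (rule ennreal_leI)
    with le show ?thesis by simp
  qed
  then show ?thesis
    by (metis ennreal_le_epsilon ennreal_Ex_less_of_nat ennreal_of_nat_eq_real_of_nat infinity_ennreal_def leD less_top)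
qed

section \<open>Rigidity and double ergodicity\<close>

lemma the_inv_step: "the_inv_into UNIV step = unstep"
proof
  show "the_inv_into UNIV step p = unstep p" for p
    by (rule the_inv_into_f_eq) (metis injI unstep_step, simp_all add: step_unstep)
qed

lemma invertible_tower: "invertible_mpt tower_measure step"
proof -
  have "bij step" by (rule bij_betw_byWitness[of _ unstep]) (auto simp: unstep_step step_unstep)
  moreover have "measurable tower_measure tower_measure = measurable base_measure base_measure"
    by (rule measurable_cong_sets) simp_all
  ultimately show ?thesis
    using measurable_step measurable_unstep
    by (simp add: invertible_mpt_def the_inv_step emeasure_step)
qed

lemma emeasure_funpow_step:
  assumes "A \<in> sets base_measure"
  shows "emeasure tower_measure ((step ^^ n) -` A) = emeasure tower_measure A"
  using assms
proof (induction n arbitrary: A)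
  case (Suc n)
  have "(step ^^ Suc n) -` A = step -` ((step ^^ n) -` A)"
    by (simp add: funpow_Suc_right vimage_comp del: funpow.simps)
  then have "emeasure tower_measure ((step ^^ Suc n) -` A) = emeasure tower_measure (step -` ((step ^^ n) -` A))"
    by (rule arg_cong)
  also have "\<dots> = emeasure tower_measure ((step ^^ n) -` A)"
    using vimage_sets[OF measurable_funpow[OF measurable_step] Suc.prems] by (rule emeasure_step)
  also have "\<dots> = emeasure tower_measure A" using Suc.prems by (rule Suc.IH)
  finally show ?case .
qed simp

lemma offset_upd:
  assumes "i < K"
  shows "offset K (x(i := v)) - offset K x = s i v - s i (x i)"
proof -
  have "offset K (x(i := v)) - offset K x = offset (Suc i) (x(i := v)) - offset (Suc i) x"
    using assms by (intro offset_extend) auto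
  also have "offset (Suc i) (x(i := v)) = offset i x + s i v"
    by (simp add: offset_def)
  finally show ?thesis by (simp add: offset_def)
qed

lemma displaced_upd:
  assumes "s i v - s i (x i) = n"
  shows "displaced n (x, k) (x(i := v), k)"
  using offset_upd[of i "Suc i" x v] assms
  unfolding displaced_def by (intro exI[of _ "Suc i"]) auto

lemma measurable_upd_fun: "(\<lambda>x. x(i := h (x i))) \<in> measurable dice dice"
proof (rule measurable_diceI)
  have "(\<lambda>x. h (x i)) \<in> measurable dice (count_space UNIV)"
    by (rule measurable_compose[OF measurable_digit measurable_count_space])
  then show "(\<lambda>x. (x(i := h (x i))) j) \<in> measurable dice (count_space UNIV)" for j
    by (cases "i = j") simp_all
qed

lemma increment_sets:
  assumes "A \<in> sets dice"
  shows "{x \<in> A. x i < c \<and> x(i := x i + 1) \<in> A} \<in> sets dice"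
proof -
  have "(\<lambda>x. x(i := x i + 1)) -` A \<inter> space dice \<in> sets dice"
    by (rule measurable_sets[OF measurable_upd_fun[of i "\<lambda>v. v + 1"] assms])
  moreover have "{x. x i < c} \<in> sets dice"
    by (rule depends_sets[of "Suc i"]) (simp add: depends_def)
  ultimately have "A \<inter> {x. x i < c} \<inter> ((\<lambda>x. x(i := x i + 1)) -` A \<inter> space dice) \<in> sets dice"
    using assms by auto
  moreover have "A \<inter> {x. x i < c} \<inter> ((\<lambda>x. x(i := x i + 1)) -` A \<inter> space dice)
      = {x \<in> A. x i < c \<and> x(i := x i + 1) \<in> A}" by auto
  ultimately show ?thesis by simp
qed

text \<open>A set determined by digits below \<open>i\<close> does not notice a change of digit
  \<open>i\<close>. After approximation the increment therefore loses only the error and the points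
  whose digit is at least \<open>g i\<close>, which \<open>small\<close> makes rare.\<close>

lemma tendsto_increment:
  assumes A [measurable]: "A \<in> sets dice" and g: "\<And>i. g i \<le> m i"
    and small: "(\<lambda>i. real (m i + 1 - g i) / real (m i + 1)) \<longlonglongrightarrow> 0"
  shows "(\<lambda>i. measure dice {x \<in> A. x i < g i \<and> x(i := x i + 1) \<in> A}) \<longlonglongrightarrow> measure dice A"
proof (rule LIMSEQ_I)
  fix r :: real assume r: "0 < r"
  obtain N B where B: "depends N B" "measure dice (A - B) + measure dice (B - A) < r / 2"
    using approx_depends[OF A, of "r / 2"] r by auto
  have [measurable]: "B \<in> sets dice" using depends_sets[OF B(1)] .
  obtain N' where N': "\<And>i. N' \<le> i \<Longrightarrow> real (m i + 1 - g i) / real (m i + 1) < r / 2"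
    using LIMSEQ_D[OF small, of "r / 2"] r by auto
  have "norm (measure dice {x \<in> A. x i < g i \<and> x(i := x i + 1) \<in> A} - measure dice A) < r"
    if i: "max N N' \<le> i" for i
  proof -
    let ?I = "{x \<in> A. x i < g i \<and> x(i := x i + 1) \<in> A}"
    \<comment> \<open>The increment is completed to a cyclic rotation of the digits, which preserves
      the measure; it wraps around only at \<open>m i\<close>, outside the range below
      \<open>g i\<close>.\<close>
    define rot where "rot a = (if a < m i then a + 1 else if a = m i then 0 else a)" for a
    define \<pi> where "\<pi> j = (if j = i then rot else id)" for j
    have "rot permutes {..m i}"
    proof (rule bij_imp_permutes)
      show "bij_betw rot {..m i} {..m i}"
        by (rule bij_betw_byWitness[where f' = "\<lambda>a. if a = 0 then m i else a - 1"])
          (auto simp: rot_def)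
    qed (auto simp: rot_def)
    then have perm: "\<pi> j permutes {..m j}" for j
      using permutes_id[of "{..m j}"] by (auto simp: \<pi>_def)
    have rot_eq: "permute \<pi> x = x(i := x i + 1)" if "x i < g i" for x
      using that g[of i] by (auto simp: permute_def \<pi>_def rot_def fun_eq_iff)
    let ?E = "permute \<pi> -` (B - A)" and ?G = "{x. x i \<in> {g i..}}"
    have sub: "A - ?I \<subseteq> (A - B) \<union> ?E \<union> ?G"
    proof
      fix x assume x: "x \<in> A - ?I"
      show "x \<in> (A - B) \<union> ?E \<union> ?G"
      proof (cases "x \<in> B \<and> x i < g i")
        case True
        then have "permute \<pi> x \<notin> A" using x rot_eq[of x] by auto
        moreover have "permute \<pi> x \<in> B"
          using True dependsD[OF B(1), of x "permute \<pi> x"] i by (auto simp: permute_def \<pi>_def)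
        ultimately show ?thesis by simp
      qed (use x in auto)
    qed
    have E_sets: "?E \<in> sets dice"
      using measurable_sets[OF measurable_permute[of \<pi>], of "B - A"] by simp
    have G_sets: "?G \<in> sets dice"
      by (rule depends_sets[of "Suc i"]) (simp add: depends_def)
    note I_sets = increment_sets[OF A, of i "g i"]
    have "measure dice (A - ?I) \<le> measure dice ((A - B) \<union> ?E \<union> ?G)"
      using sub E_sets G_sets by (intro dice.finite_measure_mono) auto
    also have "\<dots> \<le> measure dice ((A - B) \<union> ?E) + measure dice ?G"
      using E_sets G_sets by (intro measure_Un_le) auto
    also have "measure dice ((A - B) \<union> ?E) \<le> measure dice (A - B) + measure dice ?E"
      using E_sets by (intro measure_Un_le) auto
    also have "measure dice ?E = measure dice (B - A)"
      by (rule measure_permute[OF perm]) measurable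
    also have "measure dice ?G = real (m i + 1 - g i) / real (m i + 1)"
    proof -
      have "{g i..} \<inter> {..m i} = {g i..m i}" by auto
      then show ?thesis unfolding measure_digit by simp
    qed
    finally have "measure dice (A - ?I) < r"
      using B(2) N'[OF order_trans[OF max.cobounded2 i]] by linarith
    moreover have "measure dice (A - ?I) = measure dice A - measure dice ?I"
      using I_sets by (intro dice.finite_measure_Diff) auto
    ultimately show ?thesis using measure_nonneg[of dice "A - ?I"] by simp
  qed
  then show "\<exists>no. \<forall>i\<ge>no. norm (measure dice {x \<in> A. x i < g i \<and> x(i := x i + 1) \<in> A} - measure dice A) < r"
    by blast
qed

text \<open>On each floor an increment of a digit below \<open>g i\<close> is a displacement by
  \<open>H i\<close>, so each floor returns almost entirely. As \<open>A\<close> has finite measure,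
  finitely many floors hold almost all of it; the limit follows from lower bounds by finite sums and
  the trivial upper bound.\<close>

lemma rigid_tower:
  assumes g: "\<And>i. g i \<le> m i" and H: "\<And>i a. a < g i \<Longrightarrow> s i (a + 1) - s i a = int (H i)"
    and small: "(\<lambda>i. real (m i + 1 - g i) / real (m i + 1)) \<longlonglongrightarrow> 0"
    and H_top: "filterlim H at_top sequentially"
  shows "at_least_partially_rigid 1 tower_measure step"
  unfolding at_least_partially_rigid_def
proof (intro ballI impI)
  fix A assume "A \<in> sets tower_measure" and fin: "emeasure tower_measure A < \<infinity>"
  then have A: "A \<in> sets base_measure" by simp
  define R where "R i = A \<inter> (step ^^ H i) -` A" for i
  have V_sets: "(step ^^ n) -` A \<in> sets base_measure" for n
    using vimage_sets[OF measurable_funpow[OF measurable_step] A] .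
  then have R_sets: "R i \<in> sets base_measure" for i using A by (simp add: R_def)
  \<comment> \<open>Rigidity is stated with forward images, while slices are computed for preimages;
    taking the preimage under \<open>step ^^ H i\<close>, which preserves measure, exchanges the
    two.\<close>
  have image: "measure tower_measure (A \<inter> (step ^^ H i) ` A) = measure tower_measure (R i)" for i
  proof -
    note inv = funpow_inverse[of unstep step, OF unstep_step] funpow_inverse[of step unstep, OF step_unstep]
    have img: "(step ^^ H i) ` A = (unstep ^^ H i) -` A"
      using inv by (auto simp: image_iff) metis
    have "(step ^^ H i) ` A \<in> sets base_measure"
      unfolding img using vimage_sets[OF measurable_funpow[OF measurable_unstep] A] .
    with A have "A \<inter> (step ^^ H i) ` A \<in> sets base_measure" by simp
    from emeasure_funpow_step[OF this, of "H i"]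
    have "emeasure tower_measure ((step ^^ H i) -` (A \<inter> (step ^^ H i) ` A)) = emeasure tower_measure (A \<inter> (step ^^ H i) ` A)" .
    moreover have "(step ^^ H i) -` (A \<inter> (step ^^ H i) ` A) = R i"
      unfolding img by (rule set_eqI) (simp only: R_def vimage_eq Int_iff inv conj_commute)
    ultimately show ?thesis by (simp add: measure_def)
  qed
  define a where "a k = measure dice (slice A k)" for k
  define b where "b i k = measure dice {x \<in> slice A k. x i < g i \<and> x(i := x i + 1) \<in> slice A k}" for i k
  have sA: "slice A k \<in> sets dice" for k using A by (rule slice_sets)
  have b_a: "(\<lambda>i. b i k) \<longlonglongrightarrow> a k" for k
    unfolding a_def b_def using tendsto_increment[OF sA g small] .
  have fin': "emeasure tower_measure A \<noteq> \<infinity>" using fin by simp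
  have "(\<Sum>k. ennreal (a k)) = emeasure tower_measure A"
    by (simp add: emeasure_tower[OF A] a_def dice.emeasure_eq_measure)
  then have a_sums: "a sums measure tower_measure A"
  proof -
    assume eq: "(\<Sum>k. ennreal (a k)) = emeasure tower_measure A"
    have summ: "summable a"
      using fin' eq by (intro summable_suminf_not_top) (auto simp: a_def)
    then have "ennreal (suminf a) = emeasure tower_measure A"
      using eq by (subst suminf_ennreal2[symmetric]) (auto simp: a_def)
    then have "measure tower_measure A = suminf a"
      using summ by (simp add: measure_def suminf_nonneg a_def flip: \<open>ennreal (suminf a) = _\<close>)
    with summ show ?thesis by (simp add: sums_iff)
  qed
  have R_fin: "emeasure tower_measure (R i) \<noteq> \<infinity>" for i
    using emeasure_mono[of "R i" A tower_measure] A fin by (auto simp: R_def top_unique)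
  have R_ge: "(\<Sum>k<K. b i k) \<le> measure tower_measure (R i)" for i K
  proof -
    have "b i k \<le> measure dice (slice (R i) k)" for k
      unfolding b_def
    proof (rule dice.finite_measure_mono)
      show "{x \<in> slice A k. x i < g i \<and> x(i := x i + 1) \<in> slice A k} \<subseteq> slice (R i) k"
      proof safe
        fix x assume x: "x \<in> slice A k" "x i < g i" "x(i := x i + 1) \<in> slice A k"
        have "(step ^^ H i) (x, k) = (x(i := x i + 1), k)"
          using x H[OF x(2)] by (intro funpow_step_eq displaced_upd) (auto simp: slice_def)
        with x show "x \<in> slice (R i) k" by (auto simp: slice_def R_def)
      qed
      show "slice (R i) k \<in> sets dice" using R_sets by (rule slice_sets)
    qed
    then have "ennreal (\<Sum>k<K. b i k) \<le> (\<Sum>k<K. emeasure dice (slice (R i) k))"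
      by (auto simp: dice.emeasure_eq_measure sum_ennreal intro!: ennreal_leI sum_mono)
    also have "\<dots> \<le> emeasure tower_measure (R i)"
      unfolding emeasure_tower[OF R_sets] by (rule sum_le_suminf) auto
    also have "\<dots> = ennreal (measure tower_measure (R i))"
      using R_fin by (simp add: emeasure_eq_ennreal_measure)
    finally show ?thesis by (simp add: ennreal_le_iff)
  qed
  have R_le: "measure tower_measure (R i) \<le> measure tower_measure A" for i
    using A R_sets fin by (intro measure_mono_fmeasurable) (auto simp: R_def fmeasurable_def)
  have "(\<lambda>i. measure tower_measure (R i)) \<longlonglongrightarrow> measure tower_measure A"
  proof (rule order_tendstoI)
    fix c assume c: "c < measure tower_measure A"
    then have "eventually (\<lambda>K. c < (\<Sum>k<K. a k)) sequentially"
      using a_sums unfolding sums_def by (rule order_tendstoD(1)[rotated])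
    then obtain K where K: "c < (\<Sum>k<K. a k)" by (auto simp: eventually_sequentially)
    have "(\<lambda>i. \<Sum>k<K. b i k) \<longlonglongrightarrow> (\<Sum>k<K. a k)" by (intro tendsto_sum b_a)
    then have "eventually (\<lambda>i. c < (\<Sum>k<K. b i k)) sequentially" using K by (rule order_tendstoD)
    then show "eventually (\<lambda>i. c < measure tower_measure (R i)) sequentially"
      by eventually_elim (use R_ge in \<open>blast intro: less_le_trans\<close>)
  next
    fix c assume "measure tower_measure A < c"
    then show "eventually (\<lambda>i. measure tower_measure (R i) < c) sequentially"
      using R_le by (intro always_eventually) (blast intro: le_less_trans)
  qed
  then have "(\<lambda>i. measure tower_measure (A \<inter> (step ^^ H i) ` A)) \<longlonglongrightarrow> measure tower_measure A"
    by (simp only: image)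
  with H_top show "\<exists>n L. filterlim n at_top sequentially \<and>
      (\<lambda>i. measure tower_measure (A \<inter> (step ^^ n i) ` A)) \<longlonglongrightarrow> L \<and> 1 * measure tower_measure A \<le> L"
    by force
qed

lemma positive_slice:
  assumes "A \<in> sets base_measure" "0 < emeasure tower_measure A"
  obtains k where "0 < measure dice (slice A k)"
proof -
  have "\<exists>k. emeasure dice (slice A k) \<noteq> 0"
  proof (rule ccontr)
    assume "\<not> ?thesis"
    then show False using assms by (simp add: emeasure_tower)
  qed
  then show ?thesis using that by (auto simp: dice.emeasure_eq_measure zero_less_measure_iff)
qed

lemma emeasure_pos_slice:
  assumes "A \<in> sets base_measure" "0 < measure dice (slice A k)"
  shows "0 < emeasure tower_measure A"
proof -
  have "0 < emeasure dice (slice A k)" using assms(2) by (simp add: dice.emeasure_eq_measure)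
  also have "\<dots> = (\<Sum>j\<in>{k}. emeasure dice (slice A j))" by simp
  also have "\<dots> \<le> emeasure tower_measure A"
    unfolding emeasure_tower[OF assms(1)] by (rule sum_le_suminf) auto
  finally show ?thesis .
qed

text \<open>One set \<open>C\<close> of base points serves both returns: it lies in a slice of
  \<open>A\<close>, and a finite exchange of words \<open>\<pi>\<close> takes it into a slice of
  \<open>B\<close> at a constant difference of offsets. At a suitable stage, \<open>a\<close> to
  \<open>b\<close> gives the return of \<open>A\<close>, and undoing \<open>\<pi>\<close> together
  with \<open>b\<close> to \<open>c\<close> leads from \<open>B\<close> to \<open>A\<close>.
  Equality of the two times fixes \<open>d\<close>.\<close>

lemma weak_doubly_ergodic_tower:
  assumes le: "\<And>i. a i < b i" "\<And>i. b i < c i" "\<And>i. c i \<le> m i"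
    and hit: "\<And>d::int. \<exists>I. (\<forall>i\<in>I. s i (c i) - s i (b i) = s i (b i) - s i (a i) + d) \<and>
      (\<forall>N. measure dice {x. \<forall>i\<in>I. N \<le> i \<longrightarrow> x i \<notin> {a i, b i, c i}} = 0)"
  shows "weak_doubly_ergodic tower_measure step"
  unfolding weak_doubly_ergodic_def
proof (intro ballI impI)
  fix A B assume "A \<in> sets tower_measure" "B \<in> sets tower_measure"
    and pos: "0 < emeasure tower_measure A" "0 < emeasure tower_measure B"
  then have A: "A \<in> sets base_measure" and B: "B \<in> sets base_measure" by auto
  obtain k where k: "0 < measure dice (slice A k)" using positive_slice[OF A pos(1)] .
  obtain l where l: "0 < measure dice (slice B l)" using positive_slice[OF B pos(2)] .
  obtain \<pi> N e C where \<pi>: "\<And>i. \<pi> i permutes {..m i}" "\<And>i. N \<le> i \<Longrightarrow> \<pi> i = id"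
    and C: "C \<in> sets dice" "0 < measure dice C" "C \<subseteq> slice A k" "C \<subseteq> permute \<pi> -` slice B l"
    and e: "\<And>x. x \<in> C \<Longrightarrow> offset N (permute \<pi> x) - offset N x = e"
    by (rule exchange_words[OF slice_sets[OF A] slice_sets[OF B] k l]) (rule that)
  \<comment> \<open>From floor \<open>l\<close> over \<open>permute \<pi> x\<close> to floor
    \<open>k\<close> over \<open>x(i := c i)\<close> the time is \<open>k - l - e\<close> plus the
    gap from \<open>b\<close> to \<open>c\<close>. For it to equal the gap from \<open>a\<close> to
    \<open>b\<close>, the former gap must exceed the latter by \<open>e + l - k\<close>.\<close>
  obtain I where I: "\<And>i. i \<in> I \<Longrightarrow> s i (c i) - s i (b i) = s i (b i) - s i (a i) + (e + int l - int k)"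
    and null: "\<And>N. measure dice {x. \<forall>i\<in>I. N \<le> i \<longrightarrow> x i \<notin> {a i, b i, c i}} = 0"
    using hit[of "e + int l - int k"] by blast
  have ord: "a i \<le> m i" "b i \<le> m i" "c i \<le> m i" "a i \<noteq> b i" "a i \<noteq> c i" "b i \<noteq> c i" for i
    using le[of i] by auto
  obtain i where i: "i \<in> I" "0 < measure dice {x \<in> C. x i = a i \<and> x(i := b i) \<in> C}"
    "0 < measure dice {x \<in> C. x i = b i \<and> x(i := c i) \<in> C}"
    by (rule simultaneous_exchange[OF C(1,2) ord null])
  define n where "n = nat (s i (b i) - s i (a i))"
  have "height i \<le> s i (b i) - s i (a i)" by (rule gap) (use le[of i] in auto)
  then have n: "int n = s i (b i) - s i (a i)" "0 < n" using height_pos[of i] by (auto simp: n_def)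
  have V: "(step ^^ n) -` A \<in> sets base_measure"
    using vimage_sets[OF measurable_funpow[OF measurable_step] A] .
  let ?P = "A \<inter> (step ^^ n) -` A" and ?Q = "B \<inter> (step ^^ n) -` A"
  have PQ: "?P \<in> sets base_measure" "?Q \<in> sets base_measure" using V A B by auto
  have "{x \<in> C. x i = a i \<and> x(i := b i) \<in> C} \<subseteq> slice ?P k"
  proof safe
    fix x assume x: "x \<in> C" "x i = a i" "x(i := b i) \<in> C"
    then have mem: "x \<in> slice A k" "x(i := b i) \<in> slice A k" using C by auto
    then have "(step ^^ n) (x, k) = (x(i := b i), k)"
      using n x(2) by (intro funpow_step_eq displaced_upd) (auto simp: slice_def)
    with mem show "x \<in> slice ?P k" by (auto simp: slice_def)
  qed
  then have "measure dice {x \<in> C. x i = a i \<and> x(i := b i) \<in> C} \<le> measure dice (slice ?P k)"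
    by (rule dice.finite_measure_mono) (rule slice_sets[OF PQ(1)])
  with i(2) have "0 < measure dice (slice ?P k)" by simp
  then have P: "0 < emeasure tower_measure ?P" by (rule emeasure_pos_slice[OF PQ(1)])
  have "{x \<in> C. x i = b i \<and> x(i := c i) \<in> C} \<subseteq> permute \<pi> -` slice ?Q l"
  proof (rule subsetI)
    fix x assume "x \<in> {x \<in> C. x i = b i \<and> x(i := c i) \<in> C}"
    then have x: "x \<in> C" "x i = b i" "x(i := c i) \<in> C" by auto
    \<comment> \<open>Beyond \<open>?K\<close> neither the exchanged words nor digit
      \<open>i\<close> are seen, whichever of \<open>N\<close> and \<open>i\<close> is larger; both
      end points are compared with \<open>x\<close>.\<close>
    let ?K = "max N (Suc i)" and ?y = "permute \<pi> x" and ?z = "x(i := c i)"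
    have mem: "?y \<in> slice B l" "?z \<in> slice A k" using C x by auto
    have "offset ?K ?y - offset ?K x = offset N ?y - offset N x"
      by (rule offset_extend) (auto simp: permute_def \<pi>(2))
    moreover have "offset ?K ?z - offset ?K x = s i (c i) - s i (b i)"
      using offset_upd[of i ?K x "c i"] x(2) by simp
    ultimately have "int k + offset ?K ?z = int l + offset ?K ?y + int n"
      using e[OF x(1)] I[OF i(1)] n(1) by linarith
    moreover have "\<forall>j\<ge>?K. ?y j = ?z j" by (auto simp: permute_def \<pi>(2))
    ultimately have "displaced (int n) (?y, l) (?z, k)"
      unfolding displaced_def by (intro exI[of _ ?K]) simp
    then have "(step ^^ n) (?y, l) = (?z, k)"
      using mem by (intro funpow_step_eq) (auto simp: slice_def)
    with mem show "x \<in> permute \<pi> -` slice ?Q l" by (auto simp: slice_def)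
  qed
  then have "measure dice {x \<in> C. x i = b i \<and> x(i := c i) \<in> C} \<le> measure dice (permute \<pi> -` slice ?Q l)"
    using measurable_sets[OF measurable_permute[of \<pi>] slice_sets[OF PQ(2), of l]]
    by (intro dice.finite_measure_mono) auto
  also have "\<dots> = measure dice (slice ?Q l)" by (rule measure_permute[OF \<pi>(1) slice_sets[OF PQ(2)]])
  finally have "0 < measure dice (slice ?Q l)" using i(3) by simp
  then have "0 < emeasure tower_measure ?Q" by (rule emeasure_pos_slice[OF PQ(2)])
  with P n(2) show "\<exists>n>0. 0 < emeasure tower_measure (A \<inter> ((step ^^ n) -` A \<inter> space tower_measure)) \<and>
      0 < emeasure tower_measure (B \<inter> ((step ^^ n) -` A \<inter> space tower_measure))"
    by auto
qed

section \<open>The Cartesian square\<close>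

text \<open>\<open>\<Delta> i\<close> is the change at place \<open>i\<close> of the difference
  between the two coordinates. Both coordinates move by the same time, so these changes add up to
  zero. The highest nonzero one above place 0 would outweigh everything below it, so only place 0 is
  left, and it must vanish too. Only the two end points are compared; intermediate points of the
  orbit may have special digits in common.\<close>

lemma difference_rigid:
  assumes sep: "\<And>i u v u' v'. \<lbrakk>0 < i; u \<le> m i; v \<le> m i; u' \<le> m i; v' \<le> m i; \<not> (sp i u \<and> sp i v); \<not> (sp i u' \<and> sp i v');
        s i u - s i v \<noteq> s i u' - s i v'\<rbrakk> \<Longrightarrow> 2 * height i \<le> \<bar>(s i u - s i v) - (s i u' - s i v')\<bar>"
    and dig: "x \<in> digits" "y \<in> digits" "x' \<in> digits" "y' \<in> digits"
    and disp: "displaced n (x, 0) (x', 0)" "displaced n (y, 0) (y', 0)"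
    and sp: "\<And>i. 0 < i \<Longrightarrow> \<not> (sp i (x i) \<and> sp i (y i))" "\<And>i. 0 < i \<Longrightarrow> \<not> (sp i (x' i) \<and> sp i (y' i))"
  shows "s 0 (x 0) - s 0 (y 0) = s 0 (x' 0) - s 0 (y' 0)"
proof -
  define \<Delta> where "\<Delta> i = (s i (x' i) - s i (y' i)) - (s i (x i) - s i (y i))" for i
  have sum: "(\<Sum>i<N. \<Delta> i) = (offset N x' - offset N x) - (offset N y' - offset N y)" for N
    by (simp add: \<Delta>_def offset_def sum_subtractf)
  obtain N1 where N1: "\<forall>i\<ge>N1. x i = x' i" "offset N1 x' - offset N1 x = n"
    using disp(1) by (auto simp: displaced_def)
  obtain N2 where N2: "\<forall>i\<ge>N2. y i = y' i" "offset N2 y' - offset N2 y = n"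
    using disp(2) by (auto simp: displaced_def)
  define N where "N = Suc (max N1 N2)"
  have "offset N x' - offset N x = n"
    using offset_extend[of N1 x x' N] N1 by (simp add: N_def)
  moreover have "offset N y' - offset N y = n"
    using offset_extend[of N2 y y' N] N2 by (simp add: N_def)
  ultimately have zero: "(\<Sum>i<N. \<Delta> i) = 0" using sum[of N] by simp
  have "\<Delta> i = 0" if "0 < i" "i < N" for i
  proof (rule ccontr)
    assume "\<Delta> i \<noteq> 0"
    define J where "J = {i. 0 < i \<and> i < N \<and> \<Delta> i \<noteq> 0}"
    have fin: "finite J" by (rule finite_subset[of _ "{..<N}"]) (auto simp: J_def)
    have "J \<noteq> {}" using that \<open>\<Delta> i \<noteq> 0\<close> by (auto simp: J_def)
    define j where "j = Max J"
    have "j \<in> J" unfolding j_def using fin \<open>J \<noteq> {}\<close> by (rule Max_in)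
    then have j: "0 < j" "j < N" "\<Delta> j \<noteq> 0" by (auto simp: J_def)
    have top: "\<Delta> l = 0" if "j < l" "l < N" for l
    proof (rule ccontr)
      assume "\<Delta> l \<noteq> 0"
      then have "l \<in> J" using that by (simp add: J_def)
      then have "l \<le> j" unfolding j_def using fin by (intro Max_ge)
      with that show False by simp
    qed
    have "(\<Sum>l<N. \<Delta> l) = (\<Sum>l<Suc j. \<Delta> l)"
      by (rule sum.mono_neutral_right) (use j top in auto)
    with zero have "(\<Sum>l<j. \<Delta> l) + \<Delta> j = 0" by simp
    \<comment> \<open>The sum over lower places is a combination of four offsets between 0 and
      \<open>height j - 1\<close>, two with each sign.\<close>
    moreover have "\<bar>\<Sum>l<j. \<Delta> l\<bar> \<le> 2 * height j - 2"
    proof -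
      have "0 \<le> offset j x \<and> offset j x \<le> height j - 1" "0 \<le> offset j y \<and> offset j y \<le> height j - 1"
        "0 \<le> offset j x' \<and> offset j x' \<le> height j - 1" "0 \<le> offset j y' \<and> offset j y' \<le> height j - 1"
        using offset_bounds dig by auto
      then show ?thesis unfolding sum by linarith
    qed
    moreover have "2 * height j \<le> \<bar>\<Delta> j\<bar>"
      unfolding \<Delta>_def using j(3) dig sp[OF j(1)]
      by (intro sep j(1)) (auto simp: digits_le \<Delta>_def)
    ultimately show False by linarith
  qed
  then have "(\<Sum>i<N. \<Delta> i) = (\<Sum>i\<in>{0}. \<Delta> i)"
    by (intro sum.mono_neutral_right) (auto simp: N_def)
  with zero show ?thesis by (simp add: \<Delta>_def)
qed

definition ground :: "(nat \<Rightarrow> nat) set \<Rightarrow> ((nat \<Rightarrow> nat) \<times> nat) set" where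
  "ground Q = (Q \<inter> generic) \<times> {0}"

lemma ground_sets: "Q \<in> sets dice \<Longrightarrow> ground Q \<in> sets base_measure"
  unfolding ground_def by (intro pair_measureI) auto

lemma emeasure_ground:
  assumes "Q \<in> sets dice"
  shows "emeasure tower_measure (ground Q) = ennreal (measure dice Q)"
proof -
  have "emeasure tower_measure (ground Q) = (\<Sum>k. emeasure dice (slice (ground Q) k))"
    by (rule emeasure_tower[OF ground_sets[OF assms]])
  also have "\<dots> = (\<Sum>k\<in>{0}. emeasure dice (slice (ground Q) k))"
    by (rule suminf_finite) (auto simp: slice_def ground_def)
  also have "\<dots> = emeasure dice (Q \<inter> generic)"
  proof -
    have "slice (ground Q) 0 = Q \<inter> generic" using tower_zero by (auto simp: slice_def ground_def)
    then show ?thesis by simp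
  qed
  also have "\<dots> = emeasure dice Q"
    using AE_generic assms by (intro emeasure_eq_AE) auto
  finally show ?thesis by (simp add: dice.emeasure_eq_measure)
qed

text \<open>\<open>E1\<close> and \<open>E2\<close> consist of pairs of base points whose digits at
  place 0 lie in opposite halves, in the two possible orders. The difference of offsets at stage 0
  is negative on \<open>E1\<close> and positive on \<open>E2\<close>, so no orbit joins them. Each
  rectangle has measure 1/4, and \<open>Bad\<close>, the pairs with a common special stage, is
  smaller; hence both sets have positive measure.\<close>

lemma not_ergodic_square:
  assumes sep: "\<And>i u v u' v'. \<lbrakk>0 < i; u \<le> m i; v \<le> m i; u' \<le> m i; v' \<le> m i; \<not> (sp i u \<and> sp i v); \<not> (sp i u' \<and> sp i v');
        s i u - s i v \<noteq> s i u' - s i v'\<rbrakk> \<Longrightarrow> 2 * height i \<le> \<bar>(s i u - s i v) - (s i u' - s i v')\<bar>"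
    and rare: "\<And>i. measure dice {x. sp (Suc i) (x (Suc i))} \<le> p i" "summable (\<lambda>i. p i * p i)"
      "(\<Sum>i. p i * p i) < 1 / 4"
    and half: "m 0 + 1 = 2 * t"
  shows "\<not> ergodic (tower_measure \<Otimes>\<^sub>M tower_measure) (map_prod step step)"
proof -
  let ?M2 = "tower_measure \<Otimes>\<^sub>M tower_measure"
  interpret T: sigma_finite_measure tower_measure by (rule sigma_finite_tower)
  have sp_sets: "{x. sp i (x i)} \<in> sets dice" for i
    by (rule depends_sets[of "Suc i"]) (simp add: depends_def)
  have lo_sets: "{x. x 0 < t} \<in> sets dice" "{x. t \<le> x 0} \<in> sets dice"
    by (rule depends_sets[of "Suc 0"], simp add: depends_def)+
  have "measure dice {x. x 0 \<in> {..<t}} = 1 / 2" "measure dice {x. x 0 \<in> {t..}} = 1 / 2"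
  proof -
    have "{..<t} \<inter> {..m 0} = {..<t}" "{t..} \<inter> {..m 0} = {t..m 0}" "Suc (m 0) - t = t" "0 < t"
      using half by auto
    then show "measure dice {x. x 0 \<in> {..<t}} = 1 / 2" "measure dice {x. x 0 \<in> {t..}} = 1 / 2"
      unfolding measure_digit half by simp_all
  qed
  then have lo: "measure dice {x. x 0 < t} = 1 / 2" "measure dice {x. t \<le> x 0} = 1 / 2" by auto
  \<comment> \<open>\<open>Suc i\<close> leaves stage 0 out, where the digits have to range freely
    over both halves.\<close>
  define Bad where "Bad = (\<Union>i. ground {x. sp (Suc i) (x (Suc i))} \<times> ground {x. sp (Suc i) (x (Suc i))})"
  have rect: "ground Q \<times> ground Q' \<in> sets ?M2"
      "emeasure ?M2 (ground Q \<times> ground Q') = ennreal (measure dice Q * measure dice Q')"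
    if "Q \<in> sets dice" "Q' \<in> sets dice" for Q Q'
  proof -
    have g: "ground Q \<in> sets tower_measure" "ground Q' \<in> sets tower_measure"
      using ground_sets that by auto
    then show "ground Q \<times> ground Q' \<in> sets ?M2" by (rule pair_measureI)
    show "emeasure ?M2 (ground Q \<times> ground Q') = ennreal (measure dice Q * measure dice Q')"
      using T.emeasure_pair_measure_Times[OF g] that by (simp add: emeasure_ground ennreal_mult)
  qed
  have Bad_sets: "Bad \<in> sets ?M2"
    unfolding Bad_def using rect(1)[OF sp_sets sp_sets] by (intro sets.countable_UN) auto
  have "emeasure ?M2 Bad \<le> (\<Sum>i. emeasure ?M2 (ground {x. sp (Suc i) (x (Suc i))} \<times> ground {x. sp (Suc i) (x (Suc i))}))"
    unfolding Bad_def using rect(1)[OF sp_sets sp_sets] by (intro emeasure_subadditive_countably) auto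
  also have "\<dots> \<le> (\<Sum>i. ennreal (p i * p i))"
    unfolding rect(2)[OF sp_sets sp_sets] using rare(1)
    by (intro suminf_le ennreal_leI mult_mono) (auto intro: order_trans[OF measure_nonneg])
  also have "\<dots> = ennreal (\<Sum>i. p i * p i)" using rare(2) by (intro suminf_ennreal2) auto
  also have "\<dots> < ennreal (1 / 4)" using rare(3) by (simp add: ennreal_lessI)
  finally have Bad_small: "emeasure ?M2 Bad < ennreal (1 / 4)" .
  have pos: "0 < emeasure ?M2 (ground Q \<times> ground Q' - Bad)"
    if "Q \<in> sets dice" "Q' \<in> sets dice" "measure dice Q = 1 / 2" "measure dice Q' = 1 / 2" for Q Q'
  proof (rule ccontr)
    assume "\<not> ?thesis"
    then have z: "emeasure ?M2 (ground Q \<times> ground Q' - Bad) = 0" by simp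
    have "ennreal (1 / 4) = emeasure ?M2 (ground Q \<times> ground Q')" using rect(2)[OF that(1,2)] that by simp
    also have "\<dots> \<le> emeasure ?M2 ((ground Q \<times> ground Q' - Bad) \<union> Bad)"
      using rect(1)[OF that(1,2)] Bad_sets by (intro emeasure_mono) auto
    also have "\<dots> \<le> emeasure ?M2 (ground Q \<times> ground Q' - Bad) + emeasure ?M2 Bad"
      using rect(1)[OF that(1,2)] Bad_sets by (intro emeasure_subadditive) auto
    finally show False using z Bad_small by simp
  qed
  define E1 where "E1 = ground {x. x 0 < t} \<times> ground {x. t \<le> x 0} - Bad"
  define E2 where "E2 = ground {x. t \<le> x 0} \<times> ground {x. x 0 < t} - Bad"
  have E: "E1 \<in> sets ?M2" "E2 \<in> sets ?M2" "0 < emeasure ?M2 E1" "0 < emeasure ?M2 E2"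
    unfolding E1_def E2_def using rect(1) lo_sets Bad_sets pos lo by auto
  have unrelated: False if rel: "q \<in> E1" "q' \<in> E2" "displaced n (fst q) (fst q')" "displaced n (snd q) (snd q')" for q q' n
  proof -
    obtain x y where q: "q = ((x, 0), (y, 0))" "x \<in> generic" "y \<in> generic" "x 0 < t" "t \<le> y 0" "q \<notin> Bad"
      using rel(1) by (auto simp: E1_def ground_def)
    obtain x' y' where q': "q' = ((x', 0), (y', 0))" "x' \<in> generic" "y' \<in> generic" "t \<le> x' 0" "y' 0 < t" "q' \<notin> Bad"
      using rel(2) by (auto simp: E2_def ground_def)
    have sp: "\<not> (sp i (x i) \<and> sp i (y i))" "\<not> (sp i (x' i) \<and> sp i (y' i))" if "0 < i" for i
      using that q q' by (cases i; auto simp: Bad_def ground_def)+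
    have dig: "x \<in> digits" "y \<in> digits" "x' \<in> digits" "y' \<in> digits" using q q' generic_digits by auto
    have "s 0 (x 0) - s 0 (y 0) = s 0 (x' 0) - s 0 (y' 0)"
      using rel(3,4) q(1) q'(1) by (intro difference_rigid[OF sep dig _ _ sp]) auto
    moreover have "height 0 \<le> s 0 (y 0) - s 0 (x 0)" "height 0 \<le> s 0 (x' 0) - s 0 (y' 0)"
      using q q' dig by (auto intro!: gap simp: digits_le)
    ultimately show False using height_pos[of 0] by linarith
  qed
  let ?T = "map_prod step step" and ?U = "map_prod unstep unstep"
  have UT: "?U (?T q) = q" and TU: "?T (?U q) = q" for q
    by (cases q; simp add: unstep_step step_unstep)+
  \<comment> \<open>The full orbit of \<open>E1\<close>, forwards and backwards: it is strictly
    invariant, as the definition of \<open>ergodic\<close> demands.\<close>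
  define W where "W = (\<Union>n. (?T ^^ n) -` E1 \<union> (?U ^^ n) -` E1)"
  have meas: "?T \<in> measurable ?M2 ?M2" "?U \<in> measurable ?M2 ?M2"
  proof -
    have "f \<in> measurable tower_measure tower_measure \<Longrightarrow> map_prod f f \<in> measurable ?M2 ?M2" for f
      unfolding map_prod_def by (simp add: case_prod_beta')
    moreover have "measurable tower_measure tower_measure = measurable base_measure base_measure"
      by (rule measurable_cong_sets) simp_all
    ultimately show "?T \<in> measurable ?M2 ?M2" "?U \<in> measurable ?M2 ?M2"
      using measurable_step measurable_unstep by auto
  qed
  have space: "space ?M2 = UNIV" by (simp add: space_pair_measure)
  have W_sets: "W \<in> sets ?M2"
    unfolding W_def
    using measurable_sets[OF measurable_funpow[OF meas(1)] E(1)] measurable_sets[OF measurable_funpow[OF meas(2)] E(1)]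
    by (intro sets.countable_UN) (auto simp: space)
  have W_inv: "?T -` W = W"
  proof -
    have fwd: "q \<in> W" if q: "?T q \<in> W" for q
    proof -
      obtain n where "(?T ^^ n) (?T q) \<in> E1 \<or> (?U ^^ n) (?T q) \<in> E1" using q by (auto simp: W_def)
      then have "(?T ^^ Suc n) q \<in> E1 \<or> (?T ^^ 1) q \<in> E1 \<or> (\<exists>k. (?U ^^ k) q \<in> E1)"
        by (cases n) (auto simp: funpow_swap1 UT)
      then show ?thesis unfolding W_def by blast
    qed
    have bwd: "?T q \<in> W" if q: "q \<in> W" for q
    proof -
      obtain n where "(?T ^^ n) q \<in> E1 \<or> (?U ^^ n) q \<in> E1" using q by (auto simp: W_def)
      then have "(?U ^^ Suc n) (?T q) \<in> E1 \<or> (?U ^^ 1) (?T q) \<in> E1 \<or> (\<exists>k. (?T ^^ k) (?T q) \<in> E1)"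
        by (cases n) (auto simp: funpow_swap1 UT)
      then show ?thesis unfolding W_def by blast
    qed
    show ?thesis using fwd bwd by blast
  qed
  have tow: "fst q \<in> tower" "snd q \<in> tower" if "q \<in> E1 \<or> q \<in> E2" for q
    using that tower_zero by (auto simp: E1_def E2_def ground_def)
  have "q \<notin> W" if q: "q \<in> E2" for q
  proof
    assume "q \<in> W"
    then obtain n where "(?T ^^ n) q \<in> E1 \<or> (?U ^^ n) q \<in> E1" by (auto simp: W_def)
    then show False
    proof
      assume T: "(?T ^^ n) q \<in> E1"
      have "displaced (int n) (fst q) (fst ((?T ^^ n) q))" "displaced (int n) (snd q) (snd ((?T ^^ n) q))"
        using displaced_funpow tow q by (auto simp: funpow_map_prod)
      then show False using unrelated[OF T q displaced_sym displaced_sym] by blast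
    next
      assume U: "(?U ^^ n) q \<in> E1"
      have "(?T ^^ n) ((?U ^^ n) q) = q" by (rule funpow_inverse[of ?T ?U, OF TU])
      then have eq: "(step ^^ n) (fst ((?U ^^ n) q)) = fst q" "(step ^^ n) (snd ((?U ^^ n) q)) = snd q"
        by (metis funpow_map_prod fst_conv snd_conv)+
      have "displaced (int n) (fst ((?U ^^ n) q)) (fst q)" "displaced (int n) (snd ((?U ^^ n) q)) (snd q)"
        using displaced_funpow[of "fst ((?U ^^ n) q)" n] displaced_funpow[of "snd ((?U ^^ n) q)" n] tow U
        unfolding eq by auto
      then show False using unrelated[OF U q] by blast
    qed
  qed
  then have "E2 \<subseteq> UNIV - W" by blast
  moreover have "UNIV - W \<in> sets ?M2" using W_sets sets.compl_sets[of W ?M2] by (simp add: space)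
  ultimately have "0 < emeasure ?M2 (UNIV - W)"
    using emeasure_mono[of E2 "UNIV - W" ?M2] E(4) by simp
  moreover have "E1 \<subseteq> W" unfolding W_def by (rule subsetI, rule UN_I[of 0]) auto
  then have "0 < emeasure ?M2 W" using emeasure_mono[of E1 W ?M2] E(3) W_sets by simp
  ultimately show ?thesis
    unfolding ergodic_def using W_sets W_inv by (auto simp: space intro!: bexI[of _ W])
qed

end

section \<open>The offsets\<close>

text \<open>The first component of \<open>prod_decode\<close> takes every value infinitely often,
  and \<open>floor_log\<close> stretches each occurrence over a dyadic block.\<close>

definition stage_shift :: "nat \<Rightarrow> int" where
  "stage_shift i = int_decode (fst (prod_decode (floor_log i)))"

text \<open>The heights must be available before the offsets, since the spacing depends on them. The
  recursion adds the offset of the last copy; \<open>column_eq\<close> identifies the result with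
  the height required of a \<open>cutting\<close>.\<close>

fun column_height :: "nat \<Rightarrow> int" where
  "column_height 0 = 1"
| "column_height (Suc i) = column_height i + 3 * (int i + 37) * (2 * (column_height i + \<bar>stage_shift i\<bar>)) + stage_shift i"

definition spacing :: "nat \<Rightarrow> int" where
  "spacing i = 2 * (column_height i + \<bar>stage_shift i\<bar>)"

text \<open>Positions in units of \<open>spacing\<close>, with the shift kept apart, since
  separation is counted in these units. Digit \<open>i + 37\<close> is both the end of the
  progression and the first special digit.\<close>

definition place :: "nat \<Rightarrow> nat \<Rightarrow> int" where
  "place i a = (if a \<le> i + 37 then int a else if a = i + 38 then 2 * (int i + 37) else 3 * (int i + 37))"

definition copies :: "nat \<Rightarrow> nat \<Rightarrow> int" where
  "copies i a = place i a * spacing i + (if a = i + 39 then stage_shift i else 0)"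

lemma column_growth: "column_height i + 1 \<le> column_height (Suc i)" "6 * (int i + 37) * column_height i \<le> column_height (Suc i)"
  and column_pos: "1 \<le> column_height i"
proof -
  have grow: "c + 1 \<le> c + 3 * (int i + 37) * (2 * (c + \<bar>d\<bar>)) + d"
    "6 * (int i + 37) * c \<le> c + 3 * (int i + 37) * (2 * (c + \<bar>d\<bar>)) + d" if "1 \<le> c" for c d :: int and i
  proof -
    define A where "A = 6 * (int i + 37)"
    have "1 * c \<le> A * c" using that by (intro mult_right_mono) (auto simp: A_def)
    moreover have "1 * \<bar>d\<bar> \<le> A * \<bar>d\<bar>" by (intro mult_right_mono) (auto simp: A_def)
    moreover have "3 * (int i + 37) * (2 * (c + \<bar>d\<bar>)) = A * c + A * \<bar>d\<bar>"
      by (simp add: A_def algebra_simps)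
    ultimately have "c + 1 \<le> c + 3 * (int i + 37) * (2 * (c + \<bar>d\<bar>)) + d \<and>
        A * c \<le> c + 3 * (int i + 37) * (2 * (c + \<bar>d\<bar>)) + d"
      using that by linarith
    then show "c + 1 \<le> c + 3 * (int i + 37) * (2 * (c + \<bar>d\<bar>)) + d"
      "6 * (int i + 37) * c \<le> c + 3 * (int i + 37) * (2 * (c + \<bar>d\<bar>)) + d"
      by (auto simp: A_def)
  qed
  show pos: "1 \<le> column_height i" for i
  proof (induction i)
    case (Suc i)
    with grow(1)[of "column_height i" i "stage_shift i"] show ?case by simp
  qed simp
  show "column_height i + 1 \<le> column_height (Suc i)" "6 * (int i + 37) * column_height i \<le> column_height (Suc i)"
    using grow[OF pos[of i], of i "stage_shift i"] by simp_all
qed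

lemma column_eq: "1 + (\<Sum>j<i. copies j (j + 39)) = column_height i"
  by (induction i) (simp_all add: copies_def place_def spacing_def)

lemma spacing_ge: "2 * column_height i + 2 * \<bar>stage_shift i\<bar> \<le> spacing i" "0 < spacing i"
  using column_pos[of i] by (auto simp: spacing_def)

lemma place_mono: "a < b \<Longrightarrow> b \<le> i + 39 \<Longrightarrow> place i a + 1 \<le> place i b"
  by (auto simp: place_def)

text \<open>Copies are at least one \<open>spacing\<close> apart before the shift is added. The
  shift can take away at most its absolute value, and \<open>spacing\<close> is large enough to
  leave the height of the column.\<close>

interpretation rank_one: cutting "\<lambda>i. i + 39" copies
proof
  fix i a b :: nat assume ab: "a < b" "b \<le> i + 39"
  have "1 * spacing i \<le> (place i b - place i a) * spacing i"
    using place_mono[OF ab] spacing_ge[of i] by (intro mult_right_mono) auto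
  moreover have "copies i b - copies i a = (place i b - place i a) * spacing i + (if b = i + 39 then stage_shift i else 0)"
    using ab by (auto simp: copies_def algebra_simps)
  moreover have "- \<bar>stage_shift i\<bar> \<le> (if b = i + 39 then stage_shift i else 0)" by auto
  ultimately have "spacing i - \<bar>stage_shift i\<bar> \<le> copies i b - copies i a" by linarith
  then show "1 + (\<Sum>j<i. copies j (j + 39)) \<le> copies i b - copies i a"
    using spacing_ge[of i] column_pos[of i] unfolding column_eq by linarith
qed (auto simp: copies_def place_def)

lemma height_column: "rank_one.height i = column_height i"
  unfolding rank_one.height_def by (rule column_eq)

lemma copies_separated:
  assumes le: "u \<le> i + 39" "v \<le> i + 39" "u' \<le> i + 39" "v' \<le> i + 39"
    and sp: "\<not> (i + 37 \<le> u \<and> i + 37 \<le> v)" "\<not> (i + 37 \<le> u' \<and> i + 37 \<le> v')"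
    and neq: "copies i u - copies i v \<noteq> copies i u' - copies i v'"
  shows "2 * column_height i \<le> \<bar>(copies i u - copies i v) - (copies i u' - copies i v')\<bar>"
proof -
  define top :: "nat \<Rightarrow> int" where "top a = (if a = i + 39 then 1 else 0)" for a
  define P where "P = (place i u - place i v) - (place i u' - place i v')"
  define E where "E = (top u - top v) - (top u' - top v')"
  have eq: "(copies i u - copies i v) - (copies i u' - copies i v') = P * spacing i + E * stage_shift i"
    by (simp add: copies_def P_def E_def top_def algebra_simps)
  \<comment> \<open>Put \<open>q = i + 37\<close>. For a pair that is not wholly special, the
    difference of places lies in \<open>(2q, 3q]\<close> exactly if the first entry is the last
    copy, and in \<open>[-3q, -2q)\<close> exactly if the second one is. So equal differences
    contain the same multiple of the shift.\<close>
  have "P \<noteq> 0"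
  proof
    assume "P = 0"
    then have "E = 0"
      using le sp unfolding P_def E_def top_def place_def by (auto split: if_splits)
    with \<open>P = 0\<close> eq neq show False by simp
  qed
  then have "1 * spacing i \<le> \<bar>P\<bar> * spacing i" using spacing_ge(2)[of i] by (intro mult_right_mono) auto
  moreover have "\<bar>E\<bar> \<le> 2" using sp by (auto simp: E_def top_def)
  then have "\<bar>E\<bar> * \<bar>stage_shift i\<bar> \<le> 2 * \<bar>stage_shift i\<bar>" by (intro mult_right_mono) auto
  moreover have "\<bar>P * spacing i\<bar> = \<bar>P\<bar> * spacing i" "\<bar>E * stage_shift i\<bar> = \<bar>E\<bar> * \<bar>stage_shift i\<bar>"
    using spacing_ge(2)[of i] by (auto simp: abs_mult)
  ultimately show ?thesis unfolding eq using spacing_ge(1)[of i] by linarith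
qed

lemma special_rare: "measure rank_one.dice {x. i + 37 \<le> x i} = 3 / (real i + 40)"
proof -
  have "{i + 37..} \<inter> {..i + 39} = {i + 37..i + 39}" by auto
  then show ?thesis using rank_one.measure_digit[of i "{i + 37..}"] by (simp add: add.commute)
qed

lemma square_not_ergodic:
  "\<not> ergodic (rank_one.tower_measure \<Otimes>\<^sub>M rank_one.tower_measure) (map_prod rank_one.step rank_one.step)"
proof (rule rank_one.not_ergodic_square[where sp = "\<lambda>i a. i + 37 \<le> a" and p = "\<lambda>i. 3 / (real i + 41)" and t = 20])
  \<comment> \<open>Its telescoping differences dominate the squares and add up to 9/40. Forty
    digits at stage 0 are thus an even number that is large enough for the sum to stay below
    1/4.\<close>
  let ?f = "\<lambda>i. 9 * inverse (real i + 40)"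
  have "(\<lambda>i. ?f i - ?f (Suc i)) sums (?f 0 - 9 * 0)"
    by (intro telescope_sums' tendsto_mult_left) real_asymp
  then have tele: "(\<lambda>i. ?f i - ?f (Suc i)) sums (9 / 40)" by (simp add: field_simps)
  have le: "3 / (real i + 41) * (3 / (real i + 41)) \<le> ?f i - ?f (Suc i)" for i
  proof -
    have "?f i - ?f (Suc i) = 9 / ((real i + 40) * (real i + 41))" by (simp add: field_simps)
    moreover have "3 / (real i + 41) * (3 / (real i + 41)) = 9 / ((real i + 41) * (real i + 41))" by simp
    moreover have "9 / ((real i + 41) * (real i + 41)) \<le> 9 / ((real i + 40) * (real i + 41))"
      by (intro divide_left_mono mult_right_mono) auto
    ultimately show ?thesis by simp
  qed
  show summ: "summable (\<lambda>i. 3 / (real i + 41) * (3 / (real i + 41)))"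
    by (rule summable_comparison_test'[OF sums_summable[OF tele]]) (use le in auto)
  have "(\<Sum>i. 3 / (real i + 41) * (3 / (real i + 41))) \<le> (\<Sum>i. ?f i - ?f (Suc i))"
    by (rule suminf_le[OF le summ sums_summable[OF tele]])
  also have "\<dots> = 9 / 40" using tele by (rule sums_unique[symmetric])
  finally show "(\<Sum>i. 3 / (real i + 41) * (3 / (real i + 41))) < 1 / 4" by simp
  show "measure rank_one.dice {x. Suc i + 37 \<le> x (Suc i)} \<le> 3 / (real i + 41)" for i
    using special_rare[of "Suc i"] by (simp add: add.commute)
qed (use copies_separated in \<open>auto simp: height_column\<close>)

text \<open>Only three of the \<open>i + 40\<close> digits have no successor one
  \<open>spacing\<close> further on, so their probability tends to zero and no mass is lost in the
  limit.\<close>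

lemma rigid: "at_least_partially_rigid 1 rank_one.tower_measure rank_one.step"
proof (rule rank_one.rigid_tower[where g = "\<lambda>i. i + 37" and H = "\<lambda>i. nat (spacing i)"])
  show "copies i (a + 1) - copies i a = int (nat (spacing i))" if "a < i + 37" for i a
    using that spacing_ge(2)[of i] by (auto simp: copies_def place_def algebra_simps)
  show "(\<lambda>i. real (i + 39 + 1 - (i + 37)) / real (i + 39 + 1)) \<longlonglongrightarrow> 0"
    by simp real_asymp
  have le: "int i \<le> column_height i" for i
  proof (induction i)
    case (Suc i)
    with column_growth(1)[of i] show ?case by linarith
  qed simp
  have "i \<le> nat (spacing i)" for i
    using spacing_ge(1)[of i] le[of i] by linarith
  then show "filterlim (\<lambda>i. nat (spacing i)) at_top sequentially"
    by (intro filterlim_at_top_mono[OF filterlim_ident]) auto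
qed auto

text \<open>Passing to the next stage divides the weight by \<open>j + 41\<close> and multiplies the
  height by at least \<open>6 * (j + 37)\<close>, which is more than twice \<open>j + 41\<close>;
  hence the product of weight and height at least doubles. As many spacers as the height fit between
  the first two special copies.\<close>

lemma infinite_measure: "emeasure rank_one.tower_measure UNIV = \<infinity>"
proof (rule rank_one.infinite_tower)
  fix K :: real
  have ge: "2 ^ j / 40 \<le> rank_one.weight (Suc j) * real_of_int (column_height j)" for j
  proof (induction j)
    case 0
    then show ?case by (simp add: rank_one.weight_def)
  next
    case (Suc j)
    have "2 * (real j + 41) * real_of_int (column_height j) \<le> 6 * (real j + 37) * real_of_int (column_height j)"
      using column_pos[of j] by (intro mult_right_mono) auto
    also have "\<dots> = real_of_int (6 * (int j + 37) * column_height j)" by simp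
    also have "\<dots> \<le> real_of_int (column_height (Suc j))"
      using column_growth(2)[of j] by (simp only: of_int_le_iff)
    finally have col: "2 * (real j + 41) * real_of_int (column_height j) \<le> real_of_int (column_height (Suc j))" .
    have w: "rank_one.weight (Suc (Suc j)) = rank_one.weight (Suc j) / (real j + 41)"
      by (simp add: rank_one.weight_def add.commute)
    have "2 ^ Suc j / 40 \<le> 2 * (rank_one.weight (Suc j) * real_of_int (column_height j))" using Suc by simp
    also have "\<dots> = rank_one.weight (Suc (Suc j)) * (2 * (real j + 41) * real_of_int (column_height j))"
      by (simp add: w field_simps)
    also have "\<dots> \<le> rank_one.weight (Suc (Suc j)) * real_of_int (column_height (Suc j))"
      using col rank_one.weight_pos[of "Suc (Suc j)"] by (intro mult_left_mono) auto
    finally show ?case .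
  qed
  obtain j where "40 * K < 2 ^ j" using real_arch_pow[of 2 "40 * K"] by auto
  then have "K \<le> rank_one.weight (Suc j) * real_of_int (column_height j)" using ge[of j] by simp
  also have "\<dots> \<le> rank_one.weight (Suc j) * real_of_int (copies j (j + 37 + 1) - copies j (j + 37) - rank_one.height j)"
  proof (rule mult_left_mono)
    have "1 * spacing j \<le> (int j + 37) * spacing j" using spacing_ge(2)[of j] by (intro mult_right_mono) auto
    moreover have "copies j (j + 37 + 1) - copies j (j + 37) = (int j + 37) * spacing j"
      by (simp add: copies_def place_def algebra_simps)
    ultimately have "column_height j \<le> copies j (j + 37 + 1) - copies j (j + 37) - rank_one.height j"
      using spacing_ge(1)[of j] unfolding height_column by linarith
    then show "real_of_int (column_height j) \<le> real_of_int (copies j (j + 37 + 1) - copies j (j + 37) - rank_one.height j)"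
      by (simp only: of_int_le_iff)
  qed (use rank_one.weight_pos[of "Suc j"] in simp)
  finally show "\<exists>j a. a < j + 39 \<and> K \<le> rank_one.weight (Suc j) * real_of_int (copies j (a + 1) - copies j a - rank_one.height j)"
    by (intro exI[of _ j] exI[of _ "j + 37"]) simp
qed

text \<open>Every integer is the stage_shift of infinitely many blocks of stages between consecutive powers of 2,
  and each such block contributes at least 1 to the sum of the probabilities of special digits.\<close>

lemma shift_divergent:
  obtains J where "finite J" "\<And>i. i \<in> J \<Longrightarrow> N \<le> i \<and> stage_shift i = d" "real n \<le> (\<Sum>i\<in>J. 3 / (real i + 40))"
proof -
  \<comment> \<open>For exponents \<open>b \<ge> 40\<close> the bound \<open>2 ^ b \<ge> 40\<close>
    gives \<open>i + 40 < 3 * 2 ^ b\<close> on the block, so each of its \<open>2 ^ b\<close> terms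
    is at least \<open>1 / 2 ^ b\<close>.\<close>
  define K where "K = max N 40"
  define e where "e k = prod_encode (int_encode d, k)" for k
  have e: "k \<le> e k" for k unfolding e_def by (rule le_prod_encode_2)
  have inj: "inj e" by (auto simp: inj_def e_def dest: injD[OF inj_prod_encode])
  define blk where "blk b = {2 ^ b..<2 * 2 ^ b :: nat}" for b :: nat
  have log: "floor_log i = b" if "i \<in> blk b" for i b
    using that by (intro floor_log_eqI) (auto simp: blk_def intro: less_le_trans[of 0 "2 ^ b"])
  define J where "J = (\<Union>k\<in>{K..<K + n}. blk (e k))"
  show ?thesis
  proof (rule that)
    show "finite J" by (simp add: J_def blk_def)
    show "N \<le> i \<and> stage_shift i = d" if "i \<in> J" for i
    proof -
      obtain k where k: "K \<le> k" "i \<in> blk (e k)" using \<open>i \<in> J\<close> by (auto simp: J_def)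
      have "N \<le> K" by (simp add: K_def)
      also have "K \<le> e k" using k(1) e[of k] by simp
      also have "e k \<le> 2 ^ e k" by (rule less_imp_le[OF less_exp])
      also have "\<dots> \<le> i" using k(2) by (simp add: blk_def)
      finally have "N \<le> i" .
      moreover have "stage_shift i = d" using log[OF k(2)] by (simp add: stage_shift_def e_def)
      ultimately show ?thesis by simp
    qed
    have "real n = (\<Sum>k\<in>{K..<K + n}. 1)" by simp
    also have "\<dots> \<le> (\<Sum>k\<in>{K..<K + n}. \<Sum>i\<in>blk (e k). 3 / (real i + 40))"
    proof (rule sum_mono)
      fix k assume k: "k \<in> {K..<K + n}"
      let ?b = "e k"
      have "40 \<le> ?b" using k e[of k] by (simp add: K_def)
      also have "?b \<le> 2 ^ ?b" by (rule less_imp_le[OF less_exp])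
      finally have "40 \<le> (2 ^ ?b :: nat)" .
      then have "real 40 \<le> real (2 ^ ?b)" by (simp only: of_nat_le_iff)
      then have big: "40 \<le> (2 ^ ?b :: real)" by simp
      have "1 = (\<Sum>i\<in>blk ?b. 1 / 2 ^ ?b :: real)" by (simp add: blk_def)
      also have "\<dots> \<le> (\<Sum>i\<in>blk ?b. 3 / (real i + 40))"
      proof (rule sum_mono)
        fix i assume "i \<in> blk ?b"
        then have "i < 2 * 2 ^ ?b" by (simp add: blk_def)
        then have "real i < real (2 * 2 ^ ?b)" by (simp only: of_nat_less_iff)
        then have "real i < 2 * 2 ^ ?b" by simp
        with big show "1 / 2 ^ ?b \<le> 3 / (real i + 40)" by (simp add: field_simps)
      qed
      finally show "1 \<le> (\<Sum>i\<in>blk ?b. 3 / (real i + 40))" .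
    qed
    also have "\<dots> = (\<Sum>i\<in>J. 3 / (real i + 40))"
      unfolding J_def
    proof (rule sum.UNION_disjoint[symmetric])
      show "\<forall>k\<in>{K..<K + n}. \<forall>l\<in>{K..<K + n}. k \<noteq> l \<longrightarrow> blk (e k) \<inter> blk (e l) = {}"
      proof (intro ballI impI)
        fix k l :: nat assume "k \<noteq> l"
        then have "e k \<noteq> e l" using injD[OF inj] by blast
        then show "blk (e k) \<inter> blk (e l) = {}" using log[of _ "e k"] log[of _ "e l"] by force
      qed
    qed (auto simp: blk_def)
    finally show "real n \<le> (\<Sum>i\<in>J. 3 / (real i + 40))" .
  qed
qed

text \<open>The second Borel-Cantelli argument: the product of the factors
  \<open>1 - 3 / (i + 40)\<close> over finitely many stages is at most the exponential of minus the
  sum, and the sums are unbounded.\<close>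

lemma hits:
  "measure rank_one.dice {x. \<forall>i\<in>{i. stage_shift i = d}. N \<le> i \<longrightarrow> x i \<notin> {i + 37, i + 38, i + 39}} = 0"
  (is "measure _ ?Z = 0")
proof -
  have "measure rank_one.dice ?Z \<le> exp (- real n)" for n
  proof -
    obtain J where J: "finite J" "\<And>i. i \<in> J \<Longrightarrow> N \<le> i \<and> stage_shift i = d" "real n \<le> (\<Sum>i\<in>J. 3 / (real i + 40))"
      by (rule shift_divergent[of N d n]) (rule that)
    let ?B = "{x. \<forall>i\<in>J. x i \<in> - {i + 37, i + 38, i + 39}}"
    have "rank_one.depends (Suc (Max (insert 0 J))) ?B"
      using J(1) by (auto simp: rank_one.depends_def less_Suc_eq_le)
    then have "measure rank_one.dice ?Z \<le> measure rank_one.dice ?B"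
      using J(2) by (intro rank_one.dice.finite_measure_mono rank_one.depends_sets) auto
    also have "\<dots> = (\<Prod>i\<in>J. real (card (- {i + 37, i + 38, i + 39} \<inter> {..i + 39})) / real (i + 39 + 1))"
      by (rule rank_one.measure_box[OF J(1)])
    also have "\<dots> \<le> (\<Prod>i\<in>J. exp (- (3 / (real i + 40))))"
    proof (rule prod_mono)
      fix i :: nat
      have "- {i + 37, i + 38, i + 39} \<inter> {..i + 39} = {..<i + 37}" by auto
      then have "real (card (- {i + 37, i + 38, i + 39} \<inter> {..i + 39})) / real (i + 39 + 1) = 1 + - (3 / (real i + 40))"
        by (simp add: field_simps)
      also have "\<dots> \<le> exp (- (3 / (real i + 40)))" by (rule exp_ge_add_one_self)
      finally show "0 \<le> real (card (- {i + 37, i + 38, i + 39} \<inter> {..i + 39})) / real (i + 39 + 1) \<and>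
          real (card (- {i + 37, i + 38, i + 39} \<inter> {..i + 39})) / real (i + 39 + 1) \<le> exp (- (3 / (real i + 40)))"
        by simp
    qed
    also have "\<dots> = exp (- (\<Sum>i\<in>J. 3 / (real i + 40)))"
      using J(1) by (simp add: exp_sum[symmetric] sum_negf)
    also have "\<dots> \<le> exp (- real n)" using J(3) by simp
    finally show ?thesis .
  qed
  moreover have "(\<lambda>n. exp (- real n)) \<longlonglongrightarrow> 0" by real_asymp
  ultimately have "measure rank_one.dice ?Z \<le> 0"
    by (intro LIMSEQ_le_const[of "\<lambda>n. exp (- real n)"]) auto
  then show ?thesis by (simp only: measure_le_0_iff)
qed

lemma doubly_ergodic: "weak_doubly_ergodic rank_one.tower_measure rank_one.step"
proof (rule rank_one.weak_doubly_ergodic_tower[where a = "\<lambda>i. i + 37" and b = "\<lambda>i. i + 38" and c = "\<lambda>i. i + 39"])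
  fix d :: int
  have "copies i (i + 39) - copies i (i + 38) = copies i (i + 38) - copies i (i + 37) + d" if "stage_shift i = d" for i
    using that by (simp add: copies_def place_def algebra_simps)
  then show "\<exists>I. (\<forall>i\<in>I. copies i (i + 39) - copies i (i + 38) = copies i (i + 38) - copies i (i + 37) + d) \<and>
      (\<forall>N. measure rank_one.dice {x. \<forall>i\<in>I. N \<le> i \<longrightarrow> x i \<notin> {i + 37, i + 38, i + 39}} = 0)"
    using hits[of d] by (intro exI[of _ "{i. stage_shift i = d}"]) blast
qed auto

section \<open>Transport to the real line\<close>

text \<open>The topology on \<open>range f\<close> is the one carried over by \<open>f\<close>, not
  one inherited from the target type. It makes \<open>f\<close> a homeomorphism onto its range, and
  generating a sigma-algebra commutes with the preimage under \<open>inv f\<close>.\<close>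

lemma standard_Borel_embed_measure:
  fixes f :: "'a::topological_space \<Rightarrow> 'b"
  assumes inj: "inj f" and sets: "sets M = sets borel"
    and polish: "completely_metrizable_space (euclidean :: 'a topology)" "separable_space (euclidean :: 'a topology)"
  shows "standard_Borel_measure (embed_measure M f)"
proof -
  define Y where "Y = pullback_topology (range f) (inv f) euclidean"
  have space: "space M = UNIV" using sets_eq_imp_space_eq[OF sets] by simp
  have inv: "inv f -` A \<inter> range f = f ` A" for A using inj by auto
  have "homeomorphic_maps euclidean Y f (inv f)"
  proof -
    have "continuous_map euclidean Y f"
      unfolding continuous_map_def Y_def openin_pullback_topology topspace_pullback_topology inv
      using inj by (auto simp: inj_image_mem_iff)
    moreover have "continuous_map Y euclidean (inv f)"
      unfolding continuous_map_def Y_def openin_pullback_topology topspace_pullback_topology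
      by auto
    ultimately show ?thesis
      unfolding homeomorphic_maps_def using inj by (auto simp: Y_def topspace_pullback_topology)
  qed
  then have hom: "(euclidean :: 'a topology) homeomorphic_space Y"
    unfolding homeomorphic_space_def by blast
  have top: "topspace Y = range f" by (auto simp: Y_def topspace_pullback_topology)
  have "sets (embed_measure M f) = {f ` A | A. A \<in> sets borel}"
    using sets_embed_measure[OF inj, of M] sets by simp
  also have "\<dots> = {inv f -` A \<inter> range f | A. A \<in> sigma_sets UNIV {S. open S}}"
    by (simp add: inv borel_def)
  also have "\<dots> = sigma_sets (range f) {inv f -` A \<inter> range f | A. A \<in> {S. open S}}"
    by (rule sigma_sets_vimage_commute) auto
  also have "{inv f -` A \<inter> range f | A. A \<in> {S. open S}} = {U. openin Y U}"
    by (auto simp: Y_def openin_pullback_topology)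
  finally show ?thesis
    unfolding standard_Borel_measure_def
    using polish homeomorphic_completely_metrizable_space[OF hom] homeomorphic_separable_space[OF hom]
    by (intro exI[of _ Y]) (auto simp: top space space_embed_measure)
qed

locale embedded_system =
  fixes M :: "'a measure" and T :: "'a \<Rightarrow> 'a" and f :: "'a \<Rightarrow> 'b"
  assumes inj: "inj f" and space: "space M = UNIV"
begin

abbreviation image_measure :: "'b measure" where "image_measure \<equiv> embed_measure M f"

text \<open>Off \<open>range f\<close> the values of \<open>inv f\<close> are unspecified, but
  \<open>range f\<close> is the whole space of \<open>image_measure\<close>.\<close>

definition conjugate :: "'b \<Rightarrow> 'b" where "conjugate = f \<circ> T \<circ> inv f"

lemma space_image: "space image_measure = range f"
  by (simp add: space_embed_measure space)

lemma sets_image: "B \<in> sets image_measure \<Longrightarrow> \<exists>A\<in>sets M. B = f ` A"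
  using sets_embed_measure[OF inj, of M] by auto

lemma emeasure_image: "A \<in> sets M \<Longrightarrow> emeasure image_measure (f ` A) = emeasure M A"
  using inj by (rule emeasure_embed_measure_image)

lemma conjugate_funpow: "(conjugate ^^ n) (f x) = f ((T ^^ n) x)"
  by (induction n) (simp_all add: conjugate_def inj)

lemma vimage_conjugate: "(conjugate ^^ n) -` (f ` A) \<inter> space image_measure = f ` ((T ^^ n) -` A)"
  using injD[OF inj] by (force simp: space_image conjugate_funpow)

lemma image_conjugate: "(conjugate ^^ n) ` (f ` A) = f ` ((T ^^ n) ` A)"
  by (auto simp: image_iff conjugate_funpow)

lemma nonatomic_image:
  assumes "nonatomic M"
  shows "nonatomic image_measure"
  unfolding nonatomic_def
proof
  assume "\<exists>B. measure_atom image_measure B"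
  then obtain B where B: "measure_atom image_measure B" by blast
  then have "B \<in> sets image_measure" by (simp add: measure_atom_def)
  then obtain A where A: "A \<in> sets M" "B = f ` A" using sets_image by blast
  have "measure_atom M A"
    unfolding measure_atom_def
  proof (intro conjI ballI impI)
    show "0 < emeasure M A" using A B emeasure_image by (auto simp: measure_atom_def)
    fix C assume C: "C \<in> sets M" "C \<subseteq> A"
    then have "emeasure image_measure (f ` C) = 0 \<or> emeasure image_measure (f ` A - f ` C) = 0"
      using B A(2) in_sets_embed_measure[OF C(1), of f] image_mono[OF C(2), of f]
      unfolding measure_atom_def by blast
    moreover have "f ` A - f ` C = f ` (A - C)" using image_set_diff[OF inj] by simp
    ultimately show "emeasure M C = 0 \<or> emeasure M (A - C) = 0"
      using A C by (simp add: emeasure_image)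
  qed (use A in simp)
  with assms show False by (auto simp: nonatomic_def)
qed

lemma invertible_image:
  assumes "invertible_mpt M T"
  shows "invertible_mpt image_measure conjugate"
proof -
  have T: "bij T" "T \<in> measurable M M" "the_inv_into UNIV T \<in> measurable M M"
    "\<And>A. A \<in> sets M \<Longrightarrow> emeasure M (T -` A) = emeasure M A"
    using assms by (auto simp: invertible_mpt_def space)
  have R1: "conjugate (f x) = f (T x)" for x using conjugate_funpow[of 1 x] by simp
  have f_meas: "f \<in> measurable M image_measure" using inj by (rule measurable_embed_measure2)
  have bij: "bij_betw conjugate (space image_measure) (space image_measure)"
  proof (rule bij_betwI')
    show "conjugate x = conjugate y \<longleftrightarrow> x = y" if "x \<in> space image_measure" "y \<in> space image_measure" for x y
      using that inj bij_is_inj[OF T(1)] by (auto simp: space_image R1 inj_eq)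
    show "conjugate x \<in> space image_measure" if "x \<in> space image_measure" for x using that by (auto simp: space_image R1)
    show "\<exists>x\<in>space image_measure. y = conjugate x" if y: "y \<in> space image_measure" for y
    proof -
      obtain z where z: "y = f z" using y by (auto simp: space_image)
      obtain x where "z = T x" using bij_is_surj[OF T(1)] by (metis surjD)
      then have "y = conjugate (f x)" using z by (simp add: R1)
      then show ?thesis by (auto simp: space_image)
    qed
  qed
  have "the_inv_into (space image_measure) conjugate (f x) = f (the_inv_into UNIV T x)" for x
  proof (rule the_inv_into_f_eq)
    show "inj_on conjugate (space image_measure)" using bij by (simp add: bij_betw_def)
    have "T (the_inv_into UNIV T x) = x"
      using T(1) by (intro f_the_inv_into_f) (auto simp: bij_def)
    then show "conjugate (f (the_inv_into UNIV T x)) = f x" by (simp add: R1)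
  qed (simp add: space_image)
  then have "the_inv_into (space image_measure) conjugate \<in> measurable image_measure image_measure"
    using measurable_compose[OF T(3) f_meas] by (intro measurable_embed_measure1) simp
  moreover have "conjugate \<in> measurable image_measure image_measure"
    using measurable_compose[OF T(2) f_meas] by (intro measurable_embed_measure1) (simp add: R1)
  moreover have "emeasure image_measure (conjugate -` B \<inter> space image_measure) = emeasure image_measure B" if B: "B \<in> sets image_measure" for B
  proof -
    obtain A where A: "A \<in> sets M" "B = f ` A" using sets_image[OF B] by blast
    have "T -` A \<in> sets M" using measurable_sets[OF T(2) A(1)] by (simp add: space)
    then show ?thesis using vimage_conjugate[of 1 A] A T(4) by (simp add: emeasure_image)
  qed
  ultimately show ?thesis using bij by (simp add: invertible_mpt_def)
qed

lemma funpow_vimage_sets: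
  assumes "invertible_mpt M T" "A \<in> sets M"
  shows "(T ^^ n) -` A \<in> sets M"
proof -
  have "T ^^ n \<in> measurable M M"
    using assms(1) by (induction n) (auto simp: invertible_mpt_def id_def intro: measurable_comp)
  from measurable_sets[OF this assms(2)] show ?thesis by (simp add: space)
qed

lemma weak_doubly_ergodic_image:
  assumes "invertible_mpt M T" "weak_doubly_ergodic M T"
  shows "weak_doubly_ergodic image_measure conjugate"
  unfolding weak_doubly_ergodic_def
proof (intro ballI impI)
  fix C D assume "C \<in> sets image_measure" "D \<in> sets image_measure" and pos: "0 < emeasure image_measure C" "0 < emeasure image_measure D"
  then obtain A B where AB: "A \<in> sets M" "C = f ` A" "B \<in> sets M" "D = f ` B" using sets_image by meson
  then have "0 < emeasure M A" "0 < emeasure M B" using pos by (auto simp: emeasure_image)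
  then obtain n where n: "0 < n" "0 < emeasure M (A \<inter> (T ^^ n) -` A)" "0 < emeasure M (B \<inter> (T ^^ n) -` A)"
    using assms(2) AB unfolding weak_doubly_ergodic_def by (auto simp: space)
  have "emeasure image_measure (f ` A' \<inter> ((conjugate ^^ n) -` (f ` A) \<inter> space image_measure)) = emeasure M (A' \<inter> (T ^^ n) -` A)"
    if "A' \<in> sets M" for A'
    unfolding vimage_conjugate image_Int[OF inj, symmetric]
    using that funpow_vimage_sets[OF assms(1) AB(1)] by (intro emeasure_image) auto
  with n AB show "\<exists>n>0. 0 < emeasure image_measure (C \<inter> ((conjugate ^^ n) -` C \<inter> space image_measure)) \<and>
      0 < emeasure image_measure (D \<inter> ((conjugate ^^ n) -` C \<inter> space image_measure))" by auto
qed

lemma partially_rigid_image: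
  assumes "invertible_mpt M T" "at_least_partially_rigid \<rho> M T"
  shows "at_least_partially_rigid \<rho> image_measure conjugate"
  unfolding at_least_partially_rigid_def
proof (intro ballI impI)
  fix B assume "B \<in> sets image_measure" and fin: "emeasure image_measure B < \<infinity>"
  then obtain A where A: "A \<in> sets M" "B = f ` A" using sets_image by blast
  then have "emeasure M A < \<infinity>" using fin by (simp add: emeasure_image)
  then obtain n L where nL: "filterlim n at_top sequentially"
    "(\<lambda>k. measure M (A \<inter> (T ^^ n k) ` A)) \<longlonglongrightarrow> L" "\<rho> * measure M A \<le> L"
    using assms(2) A(1) unfolding at_least_partially_rigid_def by blast
  have T: "bij T" "the_inv_into UNIV T \<in> measurable M M"
    using assms(1) by (auto simp: invertible_mpt_def space)
  have "(T ^^ k) ` A \<in> sets M" for k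
  proof (induction k)
    case (Suc k)
    have "T ` ((T ^^ k) ` A) = the_inv_into UNIV T -` ((T ^^ k) ` A) \<inter> space M"
      using T(1) by (auto simp: space bij_def the_inv_into_f_f f_the_inv_into_f intro!: image_eqI)
        (metis UNIV_I f_the_inv_into_f image_eqI)
    with measurable_sets[OF T(2) Suc] show ?case by (simp add: image_comp)
  qed (use A in simp)
  then have "measure image_measure (B \<inter> (conjugate ^^ k) ` B) = measure M (A \<inter> (T ^^ k) ` A)" for k
    unfolding A(2) image_conjugate image_Int[OF inj, symmetric] measure_def using A(1)
    by (subst emeasure_image) auto
  moreover have "measure image_measure B = measure M A" using A by (simp add: measure_def emeasure_image)
  ultimately show "\<exists>n L. filterlim n at_top sequentially \<and>
      (\<lambda>k. measure image_measure (B \<inter> (conjugate ^^ n k) ` B)) \<longlonglongrightarrow> L \<and> \<rho> * measure image_measure B \<le> L"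
    using nL by auto
qed

text \<open>The square is itself an embedded system, along \<open>map_prod f f\<close>, so the
  witness of non-ergodicity is carried over as a single set. Sigma-finiteness enters where the
  product of the images is identified with the image of the product.\<close>

lemma not_ergodic_square_image:
  assumes sf: "sigma_finite_measure M" and not: "\<not> ergodic (M \<Otimes>\<^sub>M M) (map_prod T T)"
  shows "\<not> ergodic (image_measure \<Otimes>\<^sub>M image_measure) (map_prod conjugate conjugate)"
proof -
  interpret P: embedded_system "M \<Otimes>\<^sub>M M" "map_prod T T" "map_prod f f"
    by unfold_locales (use inj space in \<open>auto simp: space_pair_measure intro: prod.inj_map\<close>)
  have prod: "image_measure \<Otimes>\<^sub>M image_measure = P.image_measure"
    using embed_measure_prod[OF inj inj sf sf] by (simp add: map_prod_def)
  obtain W where W: "W \<in> sets (M \<Otimes>\<^sub>M M)" "map_prod T T -` W = W"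
    "emeasure (M \<Otimes>\<^sub>M M) W \<noteq> 0" "emeasure (M \<Otimes>\<^sub>M M) (UNIV - W) \<noteq> 0"
    using not by (auto simp: ergodic_def P.space)
  have "map_prod conjugate conjugate -` (map_prod f f ` W) \<inter> space P.image_measure = P.conjugate -` (map_prod f f ` W) \<inter> space P.image_measure"
  proof -
    have "map_prod conjugate conjugate p = P.conjugate p" if "p \<in> space P.image_measure" for p
    proof -
      obtain x y where p: "p = map_prod f f (x, y)" using \<open>p \<in> space P.image_measure\<close> unfolding P.space_image by force
      have "P.conjugate p = map_prod f f (map_prod T T (x, y))" unfolding p using P.conjugate_funpow[of 1 "(x, y)"] by simp
      moreover have "map_prod conjugate conjugate p = map_prod f f (map_prod T T (x, y))"
        using conjugate_funpow[of 1] by (simp add: p)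
      ultimately show ?thesis by simp
    qed
    then show ?thesis by auto
  qed
  also have "\<dots> = map_prod f f ` W" using P.vimage_conjugate[of 1 W] W(2) by simp
  finally have inv: "map_prod conjugate conjugate -` (map_prod f f ` W) \<inter> space P.image_measure = map_prod f f ` W" .
  have "space P.image_measure - map_prod f f ` W = map_prod f f ` (UNIV - W)"
    unfolding P.space_image using image_set_diff[OF P.inj, of UNIV W] by simp
  moreover have "UNIV - W \<in> sets (M \<Otimes>\<^sub>M M)" using sets.compl_sets[OF W(1)] by (simp add: P.space)
  ultimately have "emeasure P.image_measure (space P.image_measure - map_prod f f ` W) \<noteq> 0" "emeasure P.image_measure (map_prod f f ` W) \<noteq> 0"
    using W P.emeasure_image by auto
  with inv in_sets_embed_measure[OF W(1), of "map_prod f f"] show ?thesis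
    unfolding prod ergodic_def by blast
qed

end

section \<open>The Polish model and an injection into the reals\<close>

lemma polish_nat_seq_nat:
  "completely_metrizable_space (euclidean :: ((nat \<Rightarrow> nat) \<times> nat) topology)"
  "separable_space (euclidean :: ((nat \<Rightarrow> nat) \<times> nat) topology)"
proof -
  have "(euclidean :: nat topology) = discrete_topology UNIV"
    by (simp add: topology_eq discrete_topology_class.open_discrete)
  then have nat: "completely_metrizable_space (euclidean :: nat topology)"
    by (simp add: completely_metrizable_space_discrete_topology)
  then have "completely_metrizable_space (product_topology (\<lambda>i::nat. euclidean :: nat topology) UNIV)"
    by (simp add: completely_metrizable_space_product_topology)
  then have "completely_metrizable_space (euclidean :: (nat \<Rightarrow> nat) topology)"
    by (simp add: euclidean_product_topology)
  with nat have "completely_metrizable_space (prod_topology (euclidean :: (nat \<Rightarrow> nat) topology) (euclidean :: nat topology))"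
    by (simp only: completely_metrizable_space_prod_topology) simp
  then show "completely_metrizable_space (euclidean :: ((nat \<Rightarrow> nat) \<times> nat) topology)" by simp
  obtain D :: "((nat \<Rightarrow> nat) \<times> nat) set" where D: "countable D" "\<And>X. open X \<Longrightarrow> X \<noteq> {} \<Longrightarrow> \<exists>d\<in>D. d \<in> X"
    by (rule countable_dense_setE) (rule that)
  have "euclidean closure_of D = UNIV"
    using D(2) by (auto simp: closure_of_def)
  with D(1) show "separable_space (euclidean :: ((nat \<Rightarrow> nat) \<times> nat) topology)"
    by (auto simp: separable_space_def)
qed

lemma inj_into_real: "\<exists>f :: (nat \<Rightarrow> nat) \<times> nat \<Rightarrow> real. inj f"
proof -
  \<comment> \<open>A pair is coded by the graph of one sequence, with the floor prepended as entry
    0; sets of naturals are equinumerous with the reals.\<close>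
  define g :: "(nat \<Rightarrow> nat) \<times> nat \<Rightarrow> nat set" where
    "g p = range (\<lambda>i. prod_encode (i, case_nat (snd p) (fst p) i))" for p
  have "inj g"
  proof (rule injI)
    fix p q assume eq: "g p = g q"
    have "case_nat (snd p) (fst p) i = case_nat (snd q) (fst q) i" for i
    proof -
      have "prod_encode (i, case_nat (snd p) (fst p) i) \<in> g q" using eq by (auto simp: g_def)
      then show ?thesis by (auto simp: g_def)
    qed
    from this[of 0] this[of "Suc _"] show "p = q" by (auto simp: prod_eq_iff fun_eq_iff)
  qed
  moreover obtain h :: "nat set \<Rightarrow> real" where "inj h"
    using nat_sets_eqpoll_reals unfolding eqpoll_def bij_betw_def by blast
  ultimately show ?thesis using inj_compose by blast
qed

theorem theorem6p4:
  shows "\<exists>(M :: real measure) (T :: real \<Rightarrow> real).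
           standard_Borel_measure M \<and> sigma_finite_measure M \<and>
           emeasure M (space M) = \<infinity> \<and> nonatomic M \<and>
           invertible_mpt M T \<and>
           weak_doubly_ergodic M T \<and> partially_rigid M T \<and>
           \<not> ergodic (M \<Otimes>\<^sub>M M) (map_prod T T)"
proof -
  obtain f :: "(nat \<Rightarrow> nat) \<times> nat \<Rightarrow> real" where f: "inj f" using inj_into_real by blast
  interpret embedded_system rank_one.tower_measure rank_one.step f
    by unfold_locales (use f in simp_all)
  have "standard_Borel_measure image_measure"
    by (rule standard_Borel_embed_measure[OF f _ polish_nat_seq_nat]) (simp add: rank_one.sets_base)
  moreover have "sigma_finite_measure image_measure"
    by (rule sigma_finite_embed_measure[OF rank_one.sigma_finite_tower f])
  moreover have "emeasure image_measure (space image_measure) = \<infinity>"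
    using emeasure_image[of UNIV] sets.top[of rank_one.tower_measure] infinite_measure
    by (simp add: space_image)
  moreover have "at_least_partially_rigid 1 image_measure conjugate"
    by (rule partially_rigid_image[OF rank_one.invertible_tower rigid])
  then have "partially_rigid image_measure conjugate"
    unfolding partially_rigid_def by (intro exI[of _ 1]) simp
  ultimately show ?thesis
    using nonatomic_image[OF rank_one.nonatomic_tower] invertible_image[OF rank_one.invertible_tower]
      weak_doubly_ergodic_image[OF rank_one.invertible_tower doubly_ergodic]
      not_ergodic_square_image[OF rank_one.sigma_finite_tower square_not_ergodic]
    by blast
qed

end
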